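(* Let $n\ge 1$ and let $f$ be an entire transcendental function on $\mathbb{C}^n$ of finite order. The following statements are equivalent: (i) The algebra $\mathcal{R}^n[f]$ contains non-trivial invertible elements in $\mathcal{M}_0^n$. (ii) $f=q_1e^p+q_2$ for some $q_1,q_2\in\mathcal{R}^n$ and $p\in\mathcal{P}^n$. (iii) $\mathcal{R}^n[f]=\mathcal{R}^n[e^p]$ for some $p\in\mathcal{P}^n$. Moreover, if one of these statements holds (with $p$ the polynomial in (ii) or (iii)) and $g\in\mathcal{R}^n[f]$ is invertible in $\mathcal{M}_0^n$, then $g=re^{mp}$, where $m\ge0$ is an integer and $r\in\mathcal{R}^n$.
   Context: $\mathcal{P}^n$ and $\mathcal{R}^n$ are the spaces of polynomials, respectively rational functions, on $\mathbb{C}^n$. $\mathcal{M}_0^n$ is the algebra of meromorphic functions on $\mathbb{C}^n$ of the form $h/q$ with $h$ entire and $q\in\mathcal{P}^n$, $q\not\equiv0$ (equivalently, meromorphic functions with algebraic polar variety). For $g\in\mathcal{M}_0^n$, $\mathcal{R}^n[g]\subset\mathcal{M}_0^n$ is the subalgebra generated by $\mathcal{R}^n$ and $g$. The invertible elements of $\mathcal{M}_0^n$ are the functions $Re^h$ with $R\in\mathcal{R}^n$, $R\not\equiv0$, and $h$ entire; such $Re^h$ is called non-trivial invertible if $h$ is not constant. An entire function is transcendental if it is not a polynomial. An entire function $f$ on $\mathbb{C}^n$ has finite order if there are constants $C,\rho>0$ with $|f(z)|\le Ce^{|z|^{\rho}}$ for all $z\in\mathbb{C}^n$. *)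

theory Defs
  imports
    "HOL-Analysis.Analysis"
    "HOL-Complex_Analysis.Complex_Analysis"
    "HOL-Computational_Algebra.Computational_Algebra"
begin

no_notation fps_nth (infixl "$" 75)

section \<open>The ring of entire functions on \<open>\<complex>\<^sup>n\<close>\<close>

text \<open>
  \<open>\<complex>\<^sup>n\<close> is \<^typ>\<open>complex^'n\<close> with \<open>n = CARD('n) \<ge> 1\<close>, and \<^const>\<open>norm\<close> on it is the Euclidean norm.
  A function is entire if it is complex differentiable at every point, that is, if its real
  Frechet derivative exists and is \<open>\<complex>\<close>-linear.
\<close>

definition entire_fun :: "(complex^'n::finite \<Rightarrow> complex) \<Rightarrow> bool" where
  "entire_fun f \<longleftrightarrow>
     (\<forall>z. \<exists>D. (f has_derivative D) (at z) \<and> (\<forall>c v. D (c *s v) = c * D v))"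

lemma entire_funI:
  assumes "\<And>z. (f has_derivative D z) (at z)" and "\<And>z c v. D z (c *s v) = c * D z v"
  shows "entire_fun f"
  using assms unfolding entire_fun_def by blast

lemma entire_funE:
  assumes "entire_fun f"
  obtains D where "\<And>z. (f has_derivative D z) (at z)" and "\<And>z c v. D z (c *s v) = c * D z v"
  using assms unfolding entire_fun_def by metis

lemma entire_fun_const: "entire_fun (\<lambda>_. c)"
  by (rule entire_funI[where D = "\<lambda>_ _. 0"]) auto

lemma entire_fun_add:
  assumes "entire_fun f" "entire_fun g"
  shows "entire_fun (\<lambda>z. f z + g z)"
proof -
  obtain D where D: "\<And>z. (f has_derivative D z) (at z)" "\<And>z c v. D z (c *s v) = c * D z v"
    using entire_funE[OF assms(1)] by metis
  obtain E where E: "\<And>z. (g has_derivative E z) (at z)" "\<And>z c v. E z (c *s v) = c * E z v"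
    using entire_funE[OF assms(2)] by metis
  show ?thesis
    by (rule entire_funI[where D = "\<lambda>z v. D z v + E z v"])
       (rule has_derivative_add[OF D(1) E(1)], simp add: D(2) E(2) algebra_simps)
qed

lemma entire_fun_mult:
  assumes "entire_fun f" "entire_fun g"
  shows "entire_fun (\<lambda>z. f z * g z)"
proof -
  obtain D where D: "\<And>z. (f has_derivative D z) (at z)" "\<And>z c v. D z (c *s v) = c * D z v"
    using entire_funE[OF assms(1)] by metis
  obtain E where E: "\<And>z. (g has_derivative E z) (at z)" "\<And>z c v. E z (c *s v) = c * E z v"
    using entire_funE[OF assms(2)] by metis
  show ?thesis
    by (rule entire_funI[where D = "\<lambda>z v. f z * E z v + D z v * g z"])
       (rule has_derivative_mult[OF D(1) E(1)], simp add: D(2) E(2) algebra_simps)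
qed

lemma entire_fun_uminus: "entire_fun f \<Longrightarrow> entire_fun (\<lambda>z. - f z)"
  using entire_fun_mult[OF entire_fun_const[of "-1"], of f] by simp

lemma entire_fun_diff: "entire_fun f \<Longrightarrow> entire_fun g \<Longrightarrow> entire_fun (\<lambda>z. f z - g z)"
  using entire_fun_add[OF _ entire_fun_uminus, of f g] by simp

lemma entire_fun_exp:
  assumes "entire_fun f"
  shows "entire_fun (\<lambda>z. exp (f z))"
proof -
  obtain D where D: "\<And>z. (f has_derivative D z) (at z)" "\<And>z c v. D z (c *s v) = c * D z v"
    using entire_funE[OF assms] by metis
  have E: "((\<lambda>z. exp (f z)) has_derivative (\<lambda>v. exp (f z) * D z v)) (at z)" for z
    using diff_chain_at[OF D(1) DERIV_exp[unfolded has_field_derivative_def], of z]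
    by (simp add: o_def)
  show ?thesis
    by (rule entire_funI[where D = "\<lambda>z v. exp (f z) * D z v"]) (rule E, simp add: D(2))
qed

lemma entire_fun_line_holomorphic:
  assumes "entire_fun f"
  shows "(\<lambda>t. f (a + t *s b)) holomorphic_on UNIV"
proof -
  obtain D where D: "\<And>z. (f has_derivative D z) (at z)" "\<And>z c v. D z (c *s v) = c * D z v"
    using entire_funE[OF assms] by metis
  have L: "((\<lambda>t. a + t *s b) has_derivative (\<lambda>t. t *s b)) (at t)" for t :: complex
  proof (subst has_derivative_componentwise_within, intro ballI)
    fix i :: "complex^'a" assume "i \<in> Basis"
    have "((\<lambda>x. \<Sum>j\<in>UNIV. (a $ j + x * b $ j) \<bullet> i $ j) has_derivative
            (\<lambda>x. \<Sum>j\<in>UNIV. (x * b $ j) \<bullet> i $ j)) (at t)"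
      by (auto intro!: derivative_eq_intros)
    then show "((\<lambda>x. (a + x *s b) \<bullet> i) has_derivative (\<lambda>x. (x *s b) \<bullet> i)) (at t)"
      by (simp add: inner_vec_def)
  qed
  have "((\<lambda>t. f (a + t *s b)) has_derivative (\<lambda>t. D (a + s *s b) (t *s b))) (at s)" for s
    using diff_chain_at[OF L D(1), of s] by (simp add: o_def)
  then have "((\<lambda>t. f (a + t *s b)) has_field_derivative D (a + s *s b) b) (at s)" for s
    by (simp add: has_field_derivative_def D(2) mult_commute_abs)
  then show ?thesis
    unfolding holomorphic_on_def field_differentiable_def by auto
qed

lemma entire_fun_no_zero_divisors:
  assumes f: "entire_fun f" and g: "entire_fun g" and fg: "\<And>z. f z * g z = 0"
    and fa: "f a \<noteq> 0"
  shows "g b = 0"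
proof -
  define u where "u = (\<lambda>t. f (a + t *s (b - a)))"
  define v where "v = (\<lambda>t. g (a + t *s (b - a)))"
  have hol: "u holomorphic_on UNIV" "v holomorphic_on UNIV"
    unfolding u_def v_def using entire_fun_line_holomorphic f g by blast+
  have cont: "continuous_on UNIV u"
    using hol(1) by (rule holomorphic_on_imp_continuous_on)
  have op: "open {t. u t \<noteq> 0}"
    using open_Collect_neq[OF cont continuous_on_const] by simp
  have "0 \<in> {t. u t \<noteq> 0}"
    using fa by (simp add: u_def)
  then have lim: "0 islimpt {t. u t \<noteq> 0}"
    using op interior_limit_point interior_open by blast
  have "v 1 = 0"
    by (rule analytic_continuation[OF hol(2) open_UNIV connected_UNIV _ _ lim])
       (use fg in \<open>auto simp: u_def v_def\<close>)
  then show ?thesis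
    by (simp add: v_def)
qed

typedef (overloaded) ('n::finite) entire = "{f :: complex^'n \<Rightarrow> complex. entire_fun f}"
  morphisms ev Abs_entire
  using entire_fun_const by blast

setup_lifting type_definition_entire

lift_definition const_entire :: "complex \<Rightarrow> 'n::finite entire" is "\<lambda>c _. c"
  by (rule entire_fun_const)

lift_definition exp_entire :: "'n::finite entire \<Rightarrow> 'n entire" is "\<lambda>f z. exp (f z)"
  by (rule entire_fun_exp)

instantiation entire :: (finite) idom
begin

lift_definition zero_entire :: "'a entire" is "\<lambda>_. 0" by (rule entire_fun_const)
lift_definition one_entire :: "'a entire" is "\<lambda>_. 1" by (rule entire_fun_const)
lift_definition plus_entire :: "'a entire \<Rightarrow> 'a entire \<Rightarrow> 'a entire"
  is "\<lambda>f g z. f z + g z" by (rule entire_fun_add)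
lift_definition minus_entire :: "'a entire \<Rightarrow> 'a entire \<Rightarrow> 'a entire"
  is "\<lambda>f g z. f z - g z" by (rule entire_fun_diff)
lift_definition uminus_entire :: "'a entire \<Rightarrow> 'a entire"
  is "\<lambda>f z. - f z" by (rule entire_fun_uminus)
lift_definition times_entire :: "'a entire \<Rightarrow> 'a entire \<Rightarrow> 'a entire"
  is "\<lambda>f g z. f z * g z" by (rule entire_fun_mult)

instance
proof
  fix a b :: "'a entire"
  assume "a \<noteq> 0" "b \<noteq> 0"
  then show "a * b \<noteq> 0"
    by transfer (metis entire_fun_no_zero_divisors)
qed (transfer; auto simp: fun_eq_iff algebra_simps)+

end


section \<open>Polynomials, rational functions and the algebra \<open>\<M>\<^sub>0\<^sup>n\<close>\<close>

definition polynomial_fun :: "(complex^'n::finite \<Rightarrow> complex) \<Rightarrow> bool" where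
  "polynomial_fun f \<longleftrightarrow>
     (\<exists>(A :: ('n \<Rightarrow> nat) set) c. finite A \<and>
        (\<forall>z. f z = (\<Sum>\<alpha>\<in>A. c \<alpha> * (\<Prod>i\<in>UNIV. (z $ i) ^ \<alpha> i))))"

definition Polys :: "'n::finite entire set" where
  "Polys = {p. polynomial_fun (ev p)}"

text \<open>
  Meromorphic functions are represented as elements of the field of fractions
  \<^typ>\<open>'n entire fract\<close>, so that \<open>h/q\<close> and \<open>h'/q'\<close> are identified iff \<open>h q' = h' q\<close>; an entire
  function \<open>h\<close> is embedded as \<open>to_fract h\<close>.
\<close>

definition Rats_n :: "'n::finite entire fract set" where
  "Rats_n = {to_fract p / to_fract q | p q. p \<in> Polys \<and> q \<in> Polys \<and> q \<noteq> 0}"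

definition Mero0 :: "'n::finite entire fract set" where
  "Mero0 = {to_fract h / to_fract q | h q. q \<in> Polys \<and> q \<noteq> 0}"

definition subalgebra_Mero0 :: "'n::finite entire fract set \<Rightarrow> bool" where
  "subalgebra_Mero0 S \<longleftrightarrow>
     S \<subseteq> Mero0 \<and> 1 \<in> S \<and>
     (\<forall>a\<in>S. \<forall>b\<in>S. a + b \<in> S) \<and>
     (\<forall>a\<in>S. \<forall>b\<in>S. a * b \<in> S) \<and>
     (\<forall>c. \<forall>a\<in>S. to_fract (const_entire c) * a \<in> S)"

text \<open>\<open>\<R>\<^sup>n[g]\<close>; meaningful for \<open>g \<in> Mero0\<close>.\<close>

definition Rats_adjoin :: "'n::finite entire fract \<Rightarrow> 'n entire fract set" where
  "Rats_adjoin g = subalgebra_Mero0 hull (Rats_n \<union> {g})"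

definition invertible_Mero0 :: "'n::finite entire fract \<Rightarrow> bool" where
  "invertible_Mero0 g \<longleftrightarrow> g \<in> Mero0 \<and> (\<exists>g'\<in>Mero0. g * g' = 1)"

definition nontrivial_invertible :: "'n::finite entire fract \<Rightarrow> bool" where
  "nontrivial_invertible g \<longleftrightarrow>
     invertible_Mero0 g \<and>
     (\<exists>R\<in>Rats_n. \<exists>h. R \<noteq> 0 \<and> (\<nexists>c. h = const_entire c) \<and> g = R * to_fract (exp_entire h))"


section \<open>Growth\<close>

definition transcendental :: "'n::finite entire \<Rightarrow> bool" where
  "transcendental f \<longleftrightarrow> f \<notin> Polys"

definition finite_order :: "'n::finite entire \<Rightarrow> bool" where
  "finite_order f \<longleftrightarrow>
     (\<exists>C \<rho>. C > 0 \<and> \<rho> > 0 \<and> (\<forall>z. norm (ev f z) \<le> C * exp (norm z powr \<rho>)))"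

end

theory Submission
  imports Defs
begin

text \<open>
  Let \<open>P(f) = q e\<^sup>h\<close> with polynomial coefficients and \<open>h\<close> nonconstant; restrict to a complex line on
  which \<open>h\<close> is nonconstant, so that \<open>f\<close> is transcendental over \<open>\<complex>(t)\<close>. If \<open>F = A(f)\<close> divides a
  nonzero polynomial in the ring of entire functions, then \<open>F = \<pi> e\<^sup>k\<close> with polynomials \<open>\<pi>, k\<close>,
  because \<open>F\<close> has finite order; hence \<open>F'/F\<close> is rational. Choosing \<open>A\<close> of minimal positive degree, the
  Euclidean algorithm in \<open>\<complex>(t)[X]\<close> turns \<open>F' = (F'/F) A(f)\<close> into an equation \<open>f' = u\<^sub>1 f + u\<^sub>0\<close>, and
  a shift \<open>g = \<alpha> f + \<beta>\<close> satisfies \<open>g' = (\<omega>/\<sigma>) g\<close> with polynomials \<open>\<omega>, \<sigma>\<close>. Comparing logarithmic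
  derivatives of the terms of \<open>P\<close> rewritten in \<open>g\<close> leaves a single term, so \<open>P\<close> is a constant times the
  \<open>n\<close>-th power of \<open>n l X + p\<^bsub>n-1\<^esub>\<close>, where \<open>l, p\<^bsub>n-1\<^esub>\<close> are its two leading coefficients. As this
  involves only the coefficients of \<open>P\<close>, it holds on \<open>\<complex>\<^sup>n\<close>, and extracting an \<open>n\<close>-th root gives
  \<open>f = q\<^sub>1 e\<^sup>p + q\<^sub>2\<close>. The same comparison of terms with \<open>g = e\<^sup>p\<close> yields the last assertion.
\<close>

section \<open>Growth of entire functions of one variable\<close>

definition growth :: "nat \<Rightarrow> (complex \<Rightarrow> complex) \<Rightarrow> bool" where
  "growth N f \<longleftrightarrow> (\<exists>K. \<forall>t. norm (f t) \<le> exp (K * (1 + norm t) ^ N))"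

lemma growth_add:
  assumes "growth N f" "growth N g"
  shows "growth N (\<lambda>t. f t + g t)"
proof -
  obtain K L where K: "\<And>t. norm (f t) \<le> exp (K * (1 + norm t) ^ N)"
    and L: "\<And>t. norm (g t) \<le> exp (L * (1 + norm t) ^ N)"
    using assms unfolding growth_def by blast
  define M where "M = max K L"
  have "norm (f t + g t) \<le> exp ((M + 1) * (1 + norm t) ^ N)" for t
  proof -
    let ?x = "(1 + norm t) ^ N"
    have x: "1 \<le> ?x" by simp
    have "norm (f t) \<le> exp (M * ?x)" "norm (g t) \<le> exp (M * ?x)"
      using K[of t] L[of t] x by (fastforce simp: M_def intro: order_trans mult_right_mono)+
    then have "norm (f t + g t) \<le> 2 * exp (M * ?x)"
      using norm_triangle_ineq[of "f t" "g t"] by linarith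
    also have "\<dots> \<le> exp 1 * exp (M * ?x)"
      using exp_ge_add_one_self[of 1] by (intro mult_right_mono) auto
    also have "\<dots> = exp (1 + M * ?x)" by (simp add: exp_add)
    also have "\<dots> \<le> exp ((M + 1) * ?x)"
      using x by (simp add: algebra_simps)
    finally show ?thesis .
  qed
  then show ?thesis unfolding growth_def by blast
qed

lemma growth_mult:
  assumes "growth N f" "growth N g"
  shows "growth N (\<lambda>t. f t * g t)"
proof -
  obtain K L where K: "\<And>t. norm (f t) \<le> exp (K * (1 + norm t) ^ N)"
    and L: "\<And>t. norm (g t) \<le> exp (L * (1 + norm t) ^ N)"
    using assms unfolding growth_def by blast
  have "norm (f t * g t) \<le> exp ((K + L) * (1 + norm t) ^ N)" for t
    using mult_mono[OF K[of t] L[of t]] by (simp add: norm_mult exp_add[symmetric] algebra_simps)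
  then show ?thesis unfolding growth_def by blast
qed

lemma growth_const: "growth N (\<lambda>_. c)"
proof -
  have "norm c \<le> exp (norm c * (1 + norm t) ^ N)" for t :: complex
  proof -
    have "1 \<le> (1 + norm t) ^ N" by simp
    then have "norm c * 1 \<le> norm c * (1 + norm t) ^ N"
      by (intro mult_left_mono) auto
    then show ?thesis
      using exp_ge_add_one_self[of "norm c * (1 + norm t) ^ N"] by linarith
  qed
  then show ?thesis unfolding growth_def by blast
qed

lemma growth_ident:
  assumes "1 \<le> N"
  shows "growth N (\<lambda>t. t)"
proof -
  have "norm t \<le> exp (1 * (1 + norm t) ^ N)" for t :: complex
    using self_le_power[OF _ order_less_le_trans[OF zero_less_one assms], of "1 + norm t"]
      exp_ge_add_one_self[of "(1 + norm t) ^ N"] by (simp, smt (verit) norm_ge_zero)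
  then show ?thesis unfolding growth_def by blast
qed

lemma growth_poly: "1 \<le> N \<Longrightarrow> growth N (poly p)"
proof (induction p)
  case (pCons a p)
  have "poly (pCons a p) = (\<lambda>t. a + t * poly p t)" by auto
  then show ?case
    using growth_add[OF growth_const growth_mult[OF growth_ident pCons.IH]] pCons.prems by simp
qed (use growth_const[of N 0] in \<open>simp add: poly_0[abs_def]\<close>)

lemma poly_norm_lower:
  fixes q :: "complex poly"
  assumes "q \<noteq> 0"
  obtains c A where "c > 0" "\<And>t. A \<le> norm t \<Longrightarrow> c \<le> norm (poly q t)"
proof (cases "degree q = 0")
  case True
  then obtain d where "q = [:d:]" by (rule degree_eq_zeroE)
  then show ?thesis using assms that[of "norm d" 0] by auto
next
  case False
  then have "filterlim (poly q) at_infinity at_infinity"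
    by (intro filterlim_poly_at_infinity) auto
  then have "eventually (\<lambda>t. 1 \<le> norm (poly q t)) at_infinity"
    using filterlim_at_infinity[of 0 "poly q" at_infinity] by (auto dest: spec[of _ 1])
  then show ?thesis using that[of 1] by (auto simp: eventually_at_infinity)
qed

lemma poly_norm_upper:
  fixes p :: "complex poly"
  assumes "degree p \<le> N"
  obtains B where "B \<ge> 0" "\<And>t. 1 \<le> norm t \<Longrightarrow> norm (poly p t) \<le> B * norm t ^ N"
proof
  show "0 \<le> (\<Sum>i\<le>degree p. norm (poly.coeff p i))" by (intro sum_nonneg) auto
  fix t :: complex assume t: "1 \<le> norm t"
  have "norm (poly p t) \<le> (\<Sum>i\<le>degree p. norm (poly.coeff p i * t ^ i))"
    unfolding poly_altdef by (rule norm_sum)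
  also have "\<dots> \<le> (\<Sum>i\<le>degree p. norm (poly.coeff p i) * norm t ^ N)"
    using t assms by (intro sum_mono) (auto simp: norm_mult norm_power intro!: mult_left_mono power_increasing)
  finally show "norm (poly p t) \<le> (\<Sum>i\<le>degree p. norm (poly.coeff p i)) * norm t ^ N"
    by (simp add: sum_distrib_right)
qed

lemma entire_poly_bound_imp_poly:
  assumes "f holomorphic_on UNIV" "\<And>z. A \<le> norm z \<Longrightarrow> norm (f z) \<le> B * norm z ^ N"
  obtains p where "degree p \<le> N" "\<And>z. f z = poly p z"
proof
  let ?p = "\<Sum>k\<le>N. monom ((deriv ^^ k) f 0 / fact k) k"
  show "degree ?p \<le> N"
    by (intro degree_sum_le) (auto intro: order_trans[OF degree_monom_le])
  show "f z = poly ?p z" for z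
    using Liouville_polynomial[OF assms] by (simp add: poly_sum poly_monom)
qed

text \<open>Borel--Caratheodory: Schwarz' lemma for \<open>u/(2M - u)\<close> where \<open>Re u < M\<close>.\<close>

lemma entire_Re_bound_imp_poly:
  assumes hol: "h holomorphic_on UNIV" and Re: "\<And>z. Re (h z) \<le> K * (1 + norm z) ^ N"
  obtains p where "degree p \<le> N" "\<And>z. h z = poly p z"
proof -
  define L where "L = \<bar>K\<bar>"
  have L: "Re (h z) \<le> L * (1 + norm z) ^ N" "0 \<le> L" for z
    using Re[of z] by (auto simp: L_def intro: order_trans[OF _ mult_right_mono[of K "\<bar>K\<bar>"]])
  define B where "B = norm (h 0) + 2 * (L * 3 ^ N + norm (h 0) + 1)"
  have bound: "norm (h z) \<le> B * norm z ^ N" if z: "1 \<le> norm z" for z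
  proof -
    define r where "r = norm z"
    define M where "M = L * (1 + 2 * r) ^ N + norm (h 0) + 1"
    define u where "u = (\<lambda>w. h (of_real (2 * r) * w) - h 0)"
    define g where "g = (\<lambda>w. u w / (of_real (2 * M) - u w))"
    have r: "1 \<le> r" using z by (simp add: r_def)
    have M: "0 < M" using L(2) r by (auto simp: M_def add_nonneg_pos)
    have ReM: "Re (u w) < M" if "norm w < 1" for w
    proof -
      have "norm (of_real (2 * r) * w) \<le> 2 * r"
        using that r by (simp add: norm_mult mult_left_le)
      then have "L * (1 + norm (of_real (2 * r) * w)) ^ N \<le> L * (1 + 2 * r) ^ N"
        using L(2) by (intro mult_left_mono power_mono) auto
      then show ?thesis
        using L(1)[of "of_real (2 * r) * w"] abs_Re_le_cmod[of "h 0"] by (simp add: M_def u_def)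
    qed
    have u_hol: "u holomorphic_on ball 0 1"
      unfolding u_def
      by (intro holomorphic_intros holomorphic_on_compose_gen[OF _ hol, unfolded o_def]) auto
    have ne: "of_real (2 * M) - u w \<noteq> 0" if "norm w < 1" for w
      using ReM[OF that] M by (auto simp: complex_eq_iff)
    have g_hol: "g holomorphic_on ball 0 1"
      unfolding g_def using u_hol ne by (intro holomorphic_intros) auto
    have g_less: "norm (g w) < 1" if "norm w < 1" for w
    proof -
      have "(norm (u w))\<^sup>2 < (norm (of_real (2 * M) - u w))\<^sup>2"
        using ReM[OF that] M unfolding cmod_power2
        by (simp add: power2_eq_square algebra_simps)
      then have "norm (u w) < norm (of_real (2 * M) - u w)"
        by (rule power2_less_imp_less) simp
      then show ?thesis using ne[OF that] by (simp add: g_def norm_divide)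
    qed
    define w where "w = z / of_real (2 * r)"
    have w: "norm w = 1 / 2" using r by (auto simp: w_def norm_divide r_def)
    have "norm (g w) \<le> norm w"
      by (rule Schwarz_Lemma(1)[OF g_hol _ g_less]) (auto simp: g_def u_def w)
    then have "norm (u w) \<le> norm (of_real (2 * M) - u w) / 2"
      using ne[of w] by (simp add: g_def norm_divide w field_simps)
    also have "\<dots> \<le> (2 * M + norm (u w)) / 2"
      using norm_triangle_ineq4[of "of_real (2 * M)" "u w"] M by simp
    finally have "norm (u w) \<le> 2 * M" by simp
    moreover have "u w = h z - h 0" using r by (simp add: u_def w_def)
    ultimately have "norm (h z) \<le> norm (h 0) + 2 * M"
      using norm_triangle_sub[of "h z" "h 0"] by simp
    also have "\<dots> \<le> B * r ^ N"
    proof -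
      have "(1 + 2 * r) ^ N \<le> (3 * r) ^ N" using r by (intro power_mono) auto
      then have "L * (1 + 2 * r) ^ N \<le> L * 3 ^ N * r ^ N"
        using L(2) by (simp add: power_mult_distrib mult_left_mono mult.assoc)
      moreover have "1 \<le> r ^ N" using r by simp
      then have "norm (h 0) \<le> norm (h 0) * r ^ N" by (simp add: mult_le_cancel_left1)
      ultimately show ?thesis using \<open>1 \<le> r ^ N\<close> by (simp add: B_def M_def algebra_simps)
    qed
    finally show ?thesis by (simp add: r_def)
  qed
  show ?thesis
    using entire_poly_bound_imp_poly[OF hol bound] that by blast
qed

lemma growth_poly_mult_exp_imp_poly:
  assumes hol: "h holomorphic_on UNIV" and "q \<noteq> 0"
    and growth: "growth N (\<lambda>t. poly q t * exp (h t))"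
  obtains p where "degree p \<le> N" "\<And>z. h z = poly p z"
proof -
  obtain c A where c: "c > 0" "\<And>t. A \<le> norm t \<Longrightarrow> c \<le> norm (poly q t)"
    using poly_norm_lower[OF \<open>q \<noteq> 0\<close>] by metis
  obtain K where K: "\<And>t. norm (poly q t * exp (h t)) \<le> exp (K * (1 + norm t) ^ N)"
    using growth unfolding growth_def by blast
  have "continuous_on (cball 0 A) h"
    using hol holomorphic_on_imp_continuous_on holomorphic_on_subset by blast
  then have "bounded (h ` cball 0 A)"
    using compact_continuous_image compact_cball compact_imp_bounded by blast
  then obtain B where "\<forall>x\<in>h ` cball 0 A. norm x \<le> B"
    unfolding bounded_iff by blast
  then have B: "norm t \<le> A \<Longrightarrow> norm (h t) \<le> B" for t by auto
  define L where "L = \<bar>K\<bar> + \<bar>ln c\<bar> + \<bar>B\<bar>"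
  have "Re (h t) \<le> L * (1 + norm t) ^ N" for t
  proof -
    let ?x = "(1 + norm t) ^ N"
    have x: "1 \<le> ?x" by simp
    have le: "\<bar>a\<bar> \<le> \<bar>a\<bar> * ?x" "a * ?x \<le> \<bar>a\<bar> * ?x" for a
      using x by (auto simp: mult_le_cancel_left1 intro: mult_right_mono)
    show ?thesis
    proof (cases "A \<le> norm t")
      case True
      have "c * exp (Re (h t)) \<le> norm (poly q t) * exp (Re (h t))"
        using c(2)[OF True] by (intro mult_right_mono) auto
      also have "\<dots> \<le> exp (K * ?x)" using K[of t] by (simp add: norm_mult)
      finally have "exp (ln c + Re (h t)) \<le> exp (K * ?x)"
        using c(1) by (simp add: exp_add)
      then have "ln c + Re (h t) \<le> K * ?x" by simp
      then show ?thesis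
        using le[of K] le[of "ln c"] le[of B] by (simp add: L_def algebra_simps) linarith
    next
      case False
      then have "Re (h t) \<le> \<bar>B\<bar>" using B[of t] complex_Re_le_cmod[of "h t"] by linarith
      then show ?thesis
        using le[of K] le[of "ln c"] le[of B] by (simp add: L_def algebra_simps) linarith
    qed
  qed
  then show ?thesis using entire_Re_bound_imp_poly[OF hol] that by blast
qed

lemma eq_of_poly_mult_eq:
  fixes F G :: "complex \<Rightarrow> complex"
  assumes "continuous_on UNIV F" "continuous_on UNIV G" "d \<noteq> 0"
    and eq: "\<And>t. poly d t * F t = poly d t * G t"
  shows "F t = G t"
proof -
  have "closed {t. F t = G t}"
    using assms by (intro closed_Collect_eq) auto
  moreover have "- {t. poly d t = 0} \<subseteq> {t. F t = G t}" using eq by auto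
  ultimately have "closure (- {t. poly d t = 0}) \<subseteq> {t. F t = G t}"
    by (simp add: closure_minimal)
  moreover have "closure (- {t. poly d t = 0}) = UNIV"
    using poly_roots_finite[OF \<open>d \<noteq> 0\<close>]
    by (simp add: closure_complement empty_interior_finite)
  ultimately show ?thesis by auto
qed

lemma entire_divide_root:
  assumes "h holomorphic_on UNIV" "h a = 0"
  obtains g where "g holomorphic_on UNIV" "\<And>t. h t = (t - a) * g t"
proof
  let ?g = "\<lambda>z. if z = a then deriv h a else (h z - h a) / (z - a)"
  show "?g holomorphic_on UNIV"
    by (rule pole_lemma_open[OF assms(1) open_UNIV])
  show "h t = (t - a) * ?g t" for t using assms(2) by auto
qed

lemma entire_factor_of_poly:
  assumes "h1 holomorphic_on UNIV" "h2 holomorphic_on UNIV"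
    and "\<And>t. h1 t * h2 t = poly q t" and "q \<noteq> 0"
  obtains \<pi> k where "\<pi> \<noteq> 0" "k holomorphic_on UNIV" "\<And>t. h1 t = poly \<pi> t * exp (k t)"
  using assms
proof (induction "degree q" arbitrary: q h1 h2 thesis)
  case 0
  then obtain c where "q = [:c:]" using degree_eq_zeroE by metis
  with 0 have "h1 t \<noteq> 0" for t by force
  then obtain k where "k holomorphic_on UNIV" "\<And>t. exp (k t) = h1 t"
    using holomorphic_logarithm_exists[of UNIV h1] 0 by auto
  then show ?case using 0(2)[of 1 k] by auto
next
  case (Suc n)
  note hol = \<open>h1 holomorphic_on UNIV\<close> \<open>h2 holomorphic_on UNIV\<close>
  have "\<not> constant (poly q)" using Suc.hyps(2) by (simp add: constant_degree)
  then obtain a where a: "poly q a = 0" using fundamental_theorem_of_algebra by blast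
  then obtain q' where q': "q = [:-a, 1:] * q'" using poly_eq_0_iff_dvd by blast
  then have q'0: "q' \<noteq> 0" using \<open>q \<noteq> 0\<close> by auto
  then have deg: "n = degree q'" using Suc.hyps(2) unfolding q' by (subst (asm) degree_mult_eq) auto
  have cancel: "F t = poly q' t"
    if "F holomorphic_on UNIV" "\<And>t. (t - a) * F t = poly q t" for F t
    by (rule eq_of_poly_mult_eq[of F "poly q'" "[:-a, 1:]"])
       (use that in \<open>auto simp: q' holomorphic_on_imp_continuous_on algebra_simps intro!: continuous_intros\<close>)
  have "h1 a = 0 \<or> h2 a = 0" using Suc.prems(4)[of a] a by simp
  then show ?case
  proof
    assume "h1 a = 0"
    then obtain g where g: "g holomorphic_on UNIV" "\<And>t. h1 t = (t - a) * g t"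
      using entire_divide_root hol by metis
    have "g t * h2 t = poly q' t" for t
      by (rule cancel) (use g hol Suc.prems(4) in \<open>auto intro!: holomorphic_intros simp: mult.assoc\<close>)
    then obtain \<pi> k where "\<pi> \<noteq> 0" "k holomorphic_on UNIV" "\<And>t. g t = poly \<pi> t * exp (k t)"
      using Suc.hyps(1)[OF deg _ g(1) hol(2) _ q'0] by blast
    then show ?thesis
      using g(2) by (intro Suc.prems(1)[of "[:-a, 1:] * \<pi>" k], simp only: mult_eq_0_iff)
        (auto simp: algebra_simps)
  next
    assume "h2 a = 0"
    then obtain g where g: "g holomorphic_on UNIV" "\<And>t. h2 t = (t - a) * g t"
      using entire_divide_root hol by metis
    have "h1 t * g t = poly q' t" for t
      by (rule cancel) (use g hol Suc.prems(4) in \<open>auto intro!: holomorphic_intros simp: mult.left_commute\<close>)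
    then show ?thesis
      using Suc.hyps(1)[OF deg _ hol(1) g(1) _ q'0] Suc.prems(1) by blast
  qed
qed

section \<open>Polynomials in an entire function of one variable\<close>

definition eval2 :: "complex poly poly \<Rightarrow> complex \<Rightarrow> complex \<Rightarrow> complex" where
  "eval2 P y t = poly (poly P [:y:]) t"

lemma eval2_simps [simp]:
  "eval2 0 y t = 0"
  "eval2 (pCons c P) y t = poly c t + y * eval2 P y t"
  "eval2 (P + Q) y t = eval2 P y t + eval2 Q y t"
  "eval2 (P - Q) y t = eval2 P y t - eval2 Q y t"
  "eval2 (P * Q) y t = eval2 P y t * eval2 Q y t"
  "eval2 (Polynomial.smult c P) y t = poly c t * eval2 P y t"
  "eval2 (P ^ n) y t = eval2 P y t ^ n"
  by (simp_all add: eval2_def)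

lemma eval2_altdef: "eval2 P y t = (\<Sum>i\<le>degree P. poly (poly.coeff P i) t * y ^ i)"
  by (simp add: eval2_def poly_altdef[of P] poly_sum)

lemma eval2_has_field_derivative:
  assumes "(f has_field_derivative f') (at t)"
  shows "((\<lambda>t. eval2 P (f t) t) has_field_derivative
           eval2 (map_poly pderiv P) (f t) t + eval2 (pderiv P) (f t) t * f') (at t)"
proof (induction P)
  case (pCons c P)
  show ?case
    by (auto intro!: derivative_eq_intros pCons.IH assms
      simp: map_poly_pCons pderiv_pCons algebra_simps)
qed simp

lemma eval2_holomorphic:
  assumes "f holomorphic_on UNIV"
  shows "(\<lambda>t. eval2 P (f t) t) holomorphic_on UNIV"
  by (induction P) (auto intro!: holomorphic_intros assms)

lemma eval2_growth:
  assumes "growth N f" "1 \<le> N"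
  shows "growth N (\<lambda>t. eval2 P (f t) t)"
  by (induction P) (auto intro!: growth_add growth_mult growth_poly growth_const assms)

definition transc_fun :: "(complex \<Rightarrow> complex) \<Rightarrow> bool" where
  "transc_fun f \<longleftrightarrow> (\<forall>D. (\<forall>t. eval2 D (f t) t = 0) \<longrightarrow> D = 0)"

lemma algebraic_entire_imp_poly:
  assumes hol: "g holomorphic_on UNIV" and "D \<noteq> 0" and zero: "\<And>t. eval2 D (g t) t = 0"
    and deg: "\<And>i. degree (poly.coeff D i) \<le> N"
  obtains p where "degree p \<le> N" "\<And>z. g z = poly p z"
proof -
  define m where "m = degree D"
  obtain c A where c: "c > 0" "\<And>t. A \<le> norm t \<Longrightarrow> c \<le> norm (poly (poly.coeff D m) t)"
    using poly_norm_lower[of "poly.coeff D m"] \<open>D \<noteq> 0\<close> by (auto simp: m_def)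
  have "\<exists>B\<ge>0. \<forall>t. 1 \<le> norm t \<longrightarrow> norm (poly (poly.coeff D i) t) \<le> B * norm t ^ N" for i
    using poly_norm_upper[OF deg[of i]] by metis
  then obtain B where B: "\<And>i. 0 \<le> B i"
    "\<And>i t. 1 \<le> norm t \<Longrightarrow> norm (poly (poly.coeff D i) t) \<le> B i * norm t ^ N"
    by metis
  define S where "S = (\<Sum>i<m. B i)"
  have S: "0 \<le> S" using B(1) by (simp add: S_def sum_nonneg)
  have "norm (g t) \<le> (1 + S / c) * norm t ^ N" if t: "max A 1 \<le> norm t" for t
  proof -
    have tN: "1 \<le> norm t ^ N" using t by simp
    show ?thesis
    proof (cases "norm (g t) \<le> 1")
      case True
      also have "1 \<le> (1 + S / c) * norm t ^ N"
        using tN S c(1) mult_mono[of 1 "1 + S / c" 1 "norm t ^ N"] by simp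
      finally show ?thesis .
    next
      case False
      let ?y = "norm (g t)"
      have m0: "m \<noteq> 0"
      proof
        assume "m = 0"
        then have "poly (poly.coeff D m) t = 0" using zero[of t] by (simp add: eval2_altdef m_def)
        then show False using c t by (metis max.bounded_iff norm_zero not_less)
      qed
      have "eval2 D (g t) t = (\<Sum>i<m. poly (poly.coeff D i) t * g t ^ i) + poly (poly.coeff D m) t * g t ^ m"
        by (simp add: eval2_altdef m_def lessThan_Suc_atMost[symmetric])
      then have "poly (poly.coeff D m) t * g t ^ m = - (\<Sum>i<m. poly (poly.coeff D i) t * g t ^ i)"
        using zero[of t] by (simp add: add_eq_0_iff)
      then have "norm (poly (poly.coeff D m) t) * ?y ^ m \<le> (\<Sum>i<m. norm (poly (poly.coeff D i) t * g t ^ i))"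
        using norm_sum[of "\<lambda>i. poly (poly.coeff D i) t * g t ^ i" "{..<m}"]
        by (simp add: norm_mult[symmetric] norm_power[symmetric])
      also have "\<dots> \<le> (\<Sum>i<m. B i * norm t ^ N * ?y ^ (m - 1))"
        unfolding norm_mult norm_power using False t
        by (intro sum_mono mult_mono B(2) power_increasing) (auto simp: B(1))
      also have "\<dots> = S * norm t ^ N * ?y ^ (m - 1)" by (simp add: S_def sum_distrib_right)
      finally have "(norm (poly (poly.coeff D m) t) * ?y) * ?y ^ (m - 1) \<le> (S * norm t ^ N) * ?y ^ (m - 1)"
        using m0 by (metis mult.assoc power_eq_if)
      then have "norm (poly (poly.coeff D m) t) * ?y \<le> S * norm t ^ N"
        by (rule mult_right_le_imp_le) (use False in \<open>auto intro!: zero_less_power\<close>)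
      then have "c * ?y \<le> S * norm t ^ N"
        using c(2)[of t] t False by (smt (verit) max.bounded_iff mult_right_mono)
      then have "?y \<le> S / c * norm t ^ N" using c(1) by (simp add: field_simps)
      then show ?thesis using tN by (simp add: algebra_simps)
    qed
  qed
  then show ?thesis using entire_poly_bound_imp_poly[OF hol] that by blast
qed

lemma algebraic_entire_imp_poly':
  assumes "g holomorphic_on UNIV" and "\<not> transc_fun g"
  obtains p where "\<And>z. g z = poly p z"
proof -
  obtain D where D: "D \<noteq> 0" "\<And>t. eval2 D (g t) t = 0" using assms(2) by (auto simp: transc_fun_def)
  have "degree (poly.coeff D i) \<le> (\<Sum>j\<le>degree D. degree (poly.coeff D j))" for i
    by (cases "i \<le> degree D") (auto simp: coeff_eq_0 intro: member_le_sum)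
  then show ?thesis using algebraic_entire_imp_poly[OF assms(1) D] that by blast
qed

lemma transc_fun_exp:
  assumes hol: "h holomorphic_on UNIV" and "\<not> h constant_on UNIV"
  shows "transc_fun (\<lambda>t. exp (h t))"
proof (rule ccontr)
  assume "\<not> transc_fun (\<lambda>t. exp (h t))"
  then obtain p where p: "\<And>z. exp (h z) = poly p z"
    using algebraic_entire_imp_poly'[of "\<lambda>t. exp (h t)"] hol by (auto intro: holomorphic_intros)
  have "constant (poly p)"
    using fundamental_theorem_of_algebra[of p] p by (metis exp_not_eq_zero)
  then obtain c where "p = [:c:]" using constant_degree degree_eq_zeroE by metis
  with p have c: "exp (h z) = c" for z by simp
  have "(h has_field_derivative 0) (at z)" for z
  proof -
    have h: "(h has_field_derivative deriv h z) (at z)"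
      using hol by (simp add: holomorphic_derivI)
    then have "((\<lambda>z. exp (h z)) has_field_derivative exp (h z) * deriv h z) (at z)"
      by (auto intro!: derivative_eq_intros)
    moreover have "((\<lambda>z. exp (h z)) has_field_derivative 0) (at z)" by (simp add: c)
    ultimately have "exp (h z) * deriv h z = 0" by (rule DERIV_unique)
    then show ?thesis using h by simp
  qed
  then have "h constant_on UNIV"
    using DERIV_zero_connected_constant_on[of UNIV "{}" h] hol
    by (auto simp: holomorphic_on_imp_continuous_on)
  then show False using assms(2) by blast
qed

lemma bezout_over_idom:
  fixes A B :: "'a::idom poly"
  assumes "A \<noteq> 0"
  obtains D T U V W a where "D \<noteq> 0" "a \<noteq> 0" "Polynomial.smult a A = D * T" "Polynomial.smult a B = D * U"
    "V * T + W * U = [:a:]"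
proof -
  define I where "I D \<longleftrightarrow> D \<noteq> 0 \<and> (\<exists>V W. D = V * A + W * B)" for D
  have "I A" using assms unfolding I_def by (intro conjI exI[of _ 1] exI[of _ 0]) auto
  then obtain D where D: "I D" "\<And>D'. I D' \<Longrightarrow> degree D \<le> degree D'"
    using ex_has_least_nat[of I A degree] by blast
  then obtain V W where VW: "D = V * A + W * B" and D0: "D \<noteq> 0" unfolding I_def by auto
  have ideal: "\<exists>a T. a \<noteq> 0 \<and> Polynomial.smult a (X * A + Y * B) = D * T" for X Y
  proof -
    obtain a T where aT: "a \<noteq> 0" "Polynomial.smult a (X * A + Y * B) = D * T + pseudo_mod (X * A + Y * B) D"
      using pseudo_mod(1)[OF D0] by blast
    have "pseudo_mod (X * A + Y * B) D =
        (Polynomial.smult a X - V * T) * A + (Polynomial.smult a Y - W * T) * B"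
      using aT(2) by (simp add: VW algebra_simps smult_add_right)
    then have "pseudo_mod (X * A + Y * B) D = 0"
      using D(2) pseudo_mod(2)[OF D0, of "X * A + Y * B"] unfolding I_def by (metis not_less)
    then show ?thesis using aT by auto
  qed
  obtain a T where T: "a \<noteq> 0" "Polynomial.smult a A = D * T" using ideal[of 1 0] by auto
  obtain b U where U: "b \<noteq> 0" "Polynomial.smult b B = D * U" using ideal[of 0 1] by auto
  have T': "Polynomial.smult (a * b) A = D * Polynomial.smult b T"
    using T(2) by (metis mult.commute mult_smult_right smult_smult)
  have U': "Polynomial.smult (a * b) B = D * Polynomial.smult a U"
    using U(2) by (metis mult_smult_right smult_smult)
  have "D * (V * Polynomial.smult b T + W * Polynomial.smult a U)
      = V * (D * Polynomial.smult b T) + W * (D * Polynomial.smult a U)"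
    by (simp add: algebra_simps)
  also have "\<dots> = Polynomial.smult (a * b) (V * A + W * B)"
    by (simp only: T'[symmetric] U'[symmetric]) (simp add: smult_add_right)
  also have "\<dots> = D * [:a * b:]" by (simp add: VW[symmetric])
  finally have "V * Polynomial.smult b T + W * Polynomial.smult a U = [:a * b:]"
    using D0 mult_left_cancel by blast
  then show ?thesis using that[OF D0 _ T' U'] T(1) U(1) by simp
qed

lemma entire_mult_eq_0:
  assumes "F holomorphic_on UNIV" "G holomorphic_on UNIV" "\<And>t. F t * G t = 0" "F a \<noteq> 0"
  shows "G b = 0"
proof -
  have "open {t. F t \<noteq> 0}"
    using open_Collect_neq[OF holomorphic_on_imp_continuous_on[OF assms(1)] continuous_on_const] by simp
  then have "a islimpt {t. F t \<noteq> 0}"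
    using assms(4) interior_limit_point interior_open by blast
  then show ?thesis
    by (rule analytic_continuation[OF assms(2) open_UNIV connected_UNIV, rotated 2]) (use assms(3) in auto)
qed

lemma log_deriv_of_poly_divisor:
  assumes F: "F holomorphic_on UNIV" "growth N F"
    and h2: "h2 holomorphic_on UNIV" "\<And>t. F t * h2 t = poly Q t" and "Q \<noteq> 0"
  obtains \<pi> w where "\<pi> \<noteq> 0" "\<And>t F'. (F has_field_derivative F') (at t) \<Longrightarrow> poly \<pi> t * F' = poly w t * F t"
proof -
  obtain \<pi> k where \<pi>: "\<pi> \<noteq> 0" "k holomorphic_on UNIV" "\<And>t. F t = poly \<pi> t * exp (k t)"
    using entire_factor_of_poly[OF F(1) h2 \<open>Q \<noteq> 0\<close>] by metis
  have "growth N (\<lambda>t. poly \<pi> t * exp (k t))" using F(2) by (simp add: \<pi>(3)[abs_def])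
  then obtain p where "\<And>t. k t = poly p t"
    using growth_poly_mult_exp_imp_poly[OF \<pi>(2,1)] by metis
  then have F_eq: "F = (\<lambda>t. poly \<pi> t * exp (poly p t))" using \<pi>(3) by auto
  show ?thesis
  proof (rule that[OF \<pi>(1), of "pderiv \<pi> + \<pi> * pderiv p"])
    fix t F' assume "(F has_field_derivative F') (at t)"
    moreover have "(F has_field_derivative (poly (pderiv \<pi>) t + poly \<pi> t * poly (pderiv p) t) * exp (poly p t)) (at t)"
      unfolding F_eq by (auto intro!: derivative_eq_intros poly_DERIV simp: algebra_simps)
    ultimately have "F' = (poly (pderiv \<pi>) t + poly \<pi> t * poly (pderiv p) t) * exp (poly p t)"
      by (rule DERIV_unique)
    then show "poly \<pi> t * F' = poly (pderiv \<pi> + \<pi> * pderiv p) t * F t"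
      by (simp add: F_eq algebra_simps)
  qed
qed

lemma not_proportional_to_power:
  assumes g: "g holomorphic_on UNIV" "transc_fun g"
    and "\<sigma> \<noteq> 0" "\<And>t. poly \<sigma> t * deriv g t = poly \<omega> t * g t"
    and e: "e \<noteq> 0" "e' \<noteq> 0" and "d \<ge> 1"
    and eq: "\<sigma> * (pderiv e' * e - e' * pderiv e) = - of_nat d * \<omega> * e * e'"
  shows False
proof -
  define S where "S = UNIV - {t. poly (\<sigma> * e) t = 0}"
  have fin: "finite {t. poly (\<sigma> * e) t = 0}"
    using \<open>\<sigma> \<noteq> 0\<close> e by (intro poly_roots_finite) auto
  have conn: "connected S" unfolding S_def
    using fin by (intro connected_open_delete_finite) auto
  have op: "open S" unfolding S_def using fin by (intro open_Diff finite_imp_closed) auto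
  let ?\<phi> = "\<lambda>t. poly e' t * g t ^ d / poly e t"
  have der: "(?\<phi> has_field_derivative 0) (at t)" if "t \<in> S" for t
  proof -
    have nz: "poly \<sigma> t \<noteq> 0" "poly e t \<noteq> 0" using that by (auto simp: S_def)
    have dg: "(g has_field_derivative deriv g t) (at t)" using g(1) by (simp add: holomorphic_derivI)
    let ?n = "(poly (pderiv e') t * g t ^ d + poly e' t * (of_nat d * g t ^ (d - 1) * deriv g t)) * poly e t
        - poly e' t * g t ^ d * poly (pderiv e) t"
    have "(?\<phi> has_field_derivative ?n / (poly e t * poly e t)) (at t)"
      using nz dg by (auto intro!: derivative_eq_intros poly_DERIV simp: algebra_simps)
    moreover have "poly \<sigma> t * ?n = 0"
    proof -
      have gd: "g t ^ d = g t ^ (d - 1) * g t" using \<open>d \<ge> 1\<close> by (simp add: power_eq_if)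
      have L: "poly \<sigma> t * (poly (pderiv e') t * poly e t - poly e' t * poly (pderiv e) t)
          = - of_nat d * poly \<omega> t * poly e t * poly e' t"
        using arg_cong[OF eq, of "\<lambda>p. poly p t"] by simp
      have R: "poly \<sigma> t * ?n = g t ^ d *
          (poly \<sigma> t * (poly (pderiv e') t * poly e t - poly e' t * poly (pderiv e) t))
          + of_nat d * poly e' t * poly e t * g t ^ (d - 1) * (poly \<sigma> t * deriv g t)"
        by (simp add: algebra_simps)
      show ?thesis unfolding R L assms(4) unfolding gd by (simp add: algebra_simps)
    qed
    ultimately show ?thesis using nz by simp
  qed
  have cont: "continuous_on S ?\<phi>"
    using der DERIV_isCont continuous_at_imp_continuous_on by blast
  obtain c where c: "\<And>t. t \<in> S \<Longrightarrow> ?\<phi> t = c"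
    using DERIV_zero_connected_constant[OF conn op finite.emptyI cont] der by auto
  define D where "D = Polynomial.smult (\<sigma> * e) (Polynomial.monom e' d - [:[:c:] * e:])"
  have "eval2 D (g t) t = 0" for t
  proof (cases "t \<in> S")
    case True
    then have "poly e' t * g t ^ d = c * poly e t" using c[OF True] by (auto simp: S_def field_simps)
    then show ?thesis by (simp add: D_def eval2_def poly_monom)
  next
    case False
    then show ?thesis by (simp add: D_def S_def)
  qed
  then have "D = 0" using g(2) unfolding transc_fun_def by blast
  then have "poly.coeff D d = 0" by simp
  moreover have "poly.coeff D d = \<sigma> * e * e'"
    using \<open>d \<ge> 1\<close> by (simp add: D_def coeff_pCons split: nat.split)
  ultimately show False using \<open>\<sigma> \<noteq> 0\<close> e by simp
qed

lemma single_term_of_poly_divisor: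
  assumes g: "g holomorphic_on UNIV" "growth N g" "1 \<le> N" "transc_fun g"
    and \<sigma>: "\<sigma> \<noteq> 0" "\<And>t. poly \<sigma> t * deriv g t = poly \<omega> t * g t"
    and h2: "h2 holomorphic_on UNIV" "\<And>t. eval2 E (g t) t * h2 t = poly Q t" and "Q \<noteq> 0"
    and e: "poly.coeff E i \<noteq> 0" "poly.coeff E j \<noteq> 0"
  shows "i = j"
proof -
  let ?F = "\<lambda>t. eval2 E (g t) t"
  let ?dE = "map_poly pderiv E"
  obtain \<pi> w where \<pi>: "\<pi> \<noteq> 0"
    and w: "\<And>t F'. (?F has_field_derivative F') (at t) \<Longrightarrow> poly \<pi> t * F' = poly w t * ?F t"
    using log_deriv_of_poly_divisor[OF eval2_holomorphic[OF g(1)] eval2_growth[OF g(2,3)] h2 \<open>Q \<noteq> 0\<close>] by metis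
  define Z where "Z = Polynomial.smult (\<sigma> * \<pi>) ?dE + Polynomial.smult (\<pi> * \<omega>) (pCons 0 (pderiv E))
    - Polynomial.smult (\<sigma> * w) E"
  have "eval2 Z (g t) t = 0" for t
  proof -
    have "(?F has_field_derivative eval2 ?dE (g t) t + eval2 (pderiv E) (g t) t * deriv g t) (at t)"
      using g(1) by (intro eval2_has_field_derivative) (simp add: holomorphic_derivI)
    then have "poly \<pi> t * (eval2 ?dE (g t) t + eval2 (pderiv E) (g t) t * deriv g t) = poly w t * ?F t"
      by (rule w)
    from arg_cong[OF this, of "\<lambda>x. poly \<sigma> t * x"] have "poly \<sigma> t * poly w t * ?F t =
      poly \<sigma> t * poly \<pi> t * eval2 ?dE (g t) t + poly \<pi> t * eval2 (pderiv E) (g t) t * (poly \<sigma> t * deriv g t)"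
      by (simp add: algebra_simps)
    then show ?thesis unfolding \<sigma>(2) by (simp add: Z_def algebra_simps)
  qed
  then have "Z = 0" using g(4) unfolding transc_fun_def by blast
  have coeff: "\<sigma> * \<pi> * pderiv (poly.coeff E k) + of_nat k * \<pi> * \<omega> * poly.coeff E k = \<sigma> * w * poly.coeff E k" for k
  proof -
    have "poly.coeff Z k =
      \<sigma> * \<pi> * pderiv (poly.coeff E k) + of_nat k * \<pi> * \<omega> * poly.coeff E k - \<sigma> * w * poly.coeff E k"
      by (cases k) (simp_all add: Z_def coeff_map_poly coeff_pderiv algebra_simps)
    then show ?thesis using \<open>Z = 0\<close> by simp
  qed
  have False if "i < j" "poly.coeff E i \<noteq> 0" "poly.coeff E j \<noteq> 0" for i j
  proof -
    let ?e = "poly.coeff E i" and ?e' = "poly.coeff E j"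
    have j: "of_nat j = of_nat i + (of_nat (j - i) :: complex poly)" using that(1) by (simp flip: of_nat_add)
    have "\<pi> * (\<sigma> * (pderiv ?e' * ?e - ?e' * pderiv ?e)) =
        (\<sigma> * \<pi> * pderiv ?e') * ?e - (\<sigma> * \<pi> * pderiv ?e) * ?e'"
      by (simp add: algebra_simps)
    also have "\<dots> = (\<sigma> * w * ?e' - of_nat j * \<pi> * \<omega> * ?e') * ?e - (\<sigma> * w * ?e - of_nat i * \<pi> * \<omega> * ?e) * ?e'"
      by (simp only: eq_diff_eq[THEN iffD2, OF coeff])
    also have "\<dots> = \<pi> * (- of_nat (j - i) * \<omega> * ?e * ?e')"
      unfolding j by (simp add: algebra_simps)
    finally have "\<sigma> * (pderiv ?e' * ?e - ?e' * pderiv ?e) = - of_nat (j - i) * \<omega> * ?e * ?e'"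
      using \<pi> mult_left_cancel by blast
    then show False
      by (rule not_proportional_to_power[OF g(1,4) \<sigma> that(2,3), rotated]) (use that(1) in simp)
  qed
  then show ?thesis using e by (metis linorder_neqE_nat)
qed

lemma eval2_poly: "eval2 P (poly p t) t = poly (poly P p) t"
  by (induction P) auto

lemma eval2_pcompose_linear: "eval2 (pcompose E [:\<beta>, \<alpha>:]) y t = eval2 E (poly \<beta> t + y * poly \<alpha> t) t"
  by (induction E) (auto simp: pcompose_pCons algebra_simps)

lemma pcompose_linear_expansion:
  fixes P :: "'a::idom poly"
  obtains E where "degree E \<le> degree P" "Polynomial.smult (\<alpha> ^ degree P) P = pcompose E [:\<beta>, \<alpha>:]"
proof
  define E where "E = (\<Sum>i\<le>degree P. Polynomial.smult (poly.coeff P i * \<alpha> ^ (degree P - i)) ([:-\<beta>, 1:] ^ i))"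
  show "degree E \<le> degree P" unfolding E_def
    by (intro degree_sum_le) (auto intro: order_trans[OF degree_smult_le] simp: degree_linear_power)
  have pow: "pcompose (p ^ i) q = pcompose p q ^ i" for p q :: "'a poly" and i
    by (induction i) (auto simp: pcompose_mult pcompose_1)
  have lin: "pcompose [:-\<beta>, 1:] [:\<beta>, \<alpha>:] = Polynomial.monom \<alpha> 1"
    by (simp add: pcompose_pCons monom_altdef)
  have "pcompose E [:\<beta>, \<alpha>:] = (\<Sum>i\<le>degree P. Polynomial.smult (\<alpha> ^ degree P) (Polynomial.monom (poly.coeff P i) i))"
    unfolding E_def pcompose_sum
  proof (intro sum.cong refl)
    fix i assume "i \<in> {..degree P}"
    then have "\<alpha> ^ degree P = \<alpha> ^ (degree P - i) * \<alpha> ^ i" by (simp flip: power_add)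
    then show "pcompose (Polynomial.smult (poly.coeff P i * \<alpha> ^ (degree P - i)) ([:-\<beta>, 1:] ^ i)) [:\<beta>, \<alpha>:]
        = Polynomial.smult (\<alpha> ^ degree P) (Polynomial.monom (poly.coeff P i) i)"
      by (simp add: pcompose_smult pow lin monom_power smult_monom mult_ac)
  qed
  also have "\<dots> = Polynomial.smult (\<alpha> ^ degree P) P"
  proof -
    have "(\<Sum>i\<in>A. Polynomial.smult c (f i)) = Polynomial.smult c (\<Sum>i\<in>A. f i)" if "finite A"
      for c :: 'a and f :: "nat \<Rightarrow> 'a poly" and A
      using that by induction (auto simp: smult_add_right)
    then show ?thesis by (simp add: poly_as_sum_of_monoms)
  qed
  finally show "Polynomial.smult (\<alpha> ^ degree P) P = pcompose E [:\<beta>, \<alpha>:]" by simp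
qed

lemma not_algebraic_poly_times_exp:
  assumes "h holomorphic_on UNIV" "\<not> h constant_on UNIV" "q \<noteq> 0"
  shows "\<exists>t. poly q t * exp (h t) \<noteq> poly s t"
proof (rule ccontr)
  assume "\<not> ?thesis"
  then have "eval2 [:- s, q:] (exp (h t)) t = 0" for t by (simp add: mult.commute)
  then have "[:- s, q:] = 0" using transc_fun_exp[OF assms(1,2)] unfolding transc_fun_def by blast
  then show False using \<open>q \<noteq> 0\<close> by simp
qed

lemma transc_fun_linear:
  assumes "transc_fun f" "\<alpha> \<noteq> 0"
  shows "transc_fun (\<lambda>t. poly \<alpha> t * f t + poly \<beta> t)"
  unfolding transc_fun_def
proof (intro allI impI)
  fix D assume "\<forall>t. eval2 D (poly \<alpha> t * f t + poly \<beta> t) t = 0"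
  then have "eval2 (pcompose D [:\<beta>, \<alpha>:]) (f t) t = 0" for t
    by (simp add: eval2_pcompose_linear algebra_simps)
  then have "pcompose D [:\<beta>, \<alpha>:] = 0" using assms(1) unfolding transc_fun_def by blast
  then show "D = 0" using assms(2) by (simp add: pcompose_eq_0_iff)
qed

text \<open>The minimal degree of a polynomial \<open>A\<close> such that \<open>A(f)\<close> divides a nonzero polynomial forces
  the greatest common divisor of \<open>\<partial>A/\<partial>X\<close> and the remaining part of the equation
  \<open>\<pi> A(f)' = w A(f)\<close> to have full degree; hence \<open>f'\<close> is an affine function of \<open>f\<close>, and after
  a shift \<open>f\<close> satisfies a homogeneous linear equation.\<close>

lemma linear_differential_equation:
  assumes f: "f holomorphic_on UNIV" "growth N f" "1 \<le> N" "transc_fun f"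
    and P: "degree P \<ge> 1" and h2: "h2 holomorphic_on UNIV" "\<And>t. eval2 P (f t) t * h2 t = poly Q t" "Q \<noteq> 0"
  obtains \<alpha> \<beta> \<sigma> \<omega> where "\<alpha> \<noteq> 0" "\<sigma> \<noteq> 0"
    "\<And>t. poly \<sigma> t * deriv (\<lambda>t. poly \<alpha> t * f t + poly \<beta> t) t = poly \<omega> t * (poly \<alpha> t * f t + poly \<beta> t)"
proof -
  define G where "G A \<longleftrightarrow> 1 \<le> degree A \<and>
    (\<exists>h2 Q. h2 holomorphic_on UNIV \<and> Q \<noteq> 0 \<and> (\<forall>t. eval2 A (f t) t * h2 t = poly Q t))" for A
  have "G P" unfolding G_def using P h2 by blast
  then obtain A where "G A" and min: "\<And>B. G B \<Longrightarrow> degree A \<le> degree B"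
    using ex_has_least_nat[of G P degree] by blast
  then obtain h2 Q where A: "1 \<le> degree A" "h2 holomorphic_on UNIV" "Q \<noteq> 0"
      "\<And>t. eval2 A (f t) t * h2 t = poly Q t"
    unfolding G_def by blast
  have df: "(f has_field_derivative deriv f t) (at t)" for t using f(1) by (simp add: holomorphic_derivI)
  obtain \<pi> w where \<pi>: "\<pi> \<noteq> 0"
    and w: "\<And>t F'. ((\<lambda>t. eval2 A (f t) t) has_field_derivative F') (at t) \<Longrightarrow> poly \<pi> t * F' = poly w t * eval2 A (f t) t"
    using log_deriv_of_poly_divisor[OF eval2_holomorphic[OF f(1)] eval2_growth[OF f(2,3)] A(2,4,3)] by metis
  define A1 where "A1 = Polynomial.smult \<pi> (pderiv A)"
  define B1 where "B1 = Polynomial.smult \<pi> (map_poly pderiv A) - Polynomial.smult w A"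
  have ode: "eval2 A1 (f t) t * deriv f t + eval2 B1 (f t) t = 0" for t
    using w[OF eval2_has_field_derivative[OF df]] by (simp add: A1_def B1_def algebra_simps)
  have "pderiv A \<noteq> 0" using A(1) by (simp add: pderiv_eq_0_iff)
  then have A1: "A1 \<noteq> 0" "degree A1 = degree A - 1" using \<pi> by (auto simp: A1_def degree_pderiv)
  obtain D T U V W a where D: "D \<noteq> 0" and a: "a \<noteq> 0"
    and T: "Polynomial.smult a A1 = D * T" and U: "Polynomial.smult a B1 = D * U" and VW: "V * T + W * U = [:a:]"
    using bezout_over_idom[OF A1(1)] by metis
  obtain t0 where t0: "eval2 D (f t0) t0 \<noteq> 0" using D f(4) unfolding transc_fun_def by blast
  let ?H = "\<lambda>t. eval2 T (f t) t * deriv f t + eval2 U (f t) t"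
  have df_hol: "deriv f holomorphic_on UNIV" using f(1) by (simp add: holomorphic_deriv)
  have "eval2 D (f t) t * ?H t = 0" for t
  proof -
    have "eval2 D (f t) t * ?H t = eval2 (D * T) (f t) t * deriv f t + eval2 (D * U) (f t) t"
      by (simp add: algebra_simps)
    also have "\<dots> = poly a t * (eval2 A1 (f t) t * deriv f t + eval2 B1 (f t) t)"
      unfolding T[symmetric] U[symmetric] by (simp add: algebra_simps)
    finally show ?thesis by (simp add: ode)
  qed
  then have TU: "?H t = 0" for t
    by (rule entire_mult_eq_0[OF eval2_holomorphic[OF f(1)] _ _ t0, rotated])
       (intro holomorphic_intros eval2_holomorphic f(1) df_hol)
  have inv: "eval2 T (f t) t * (eval2 V (f t) t - eval2 W (f t) t * deriv f t) = poly a t" for t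
  proof -
    have "eval2 U (f t) t = - eval2 T (f t) t * deriv f t" using TU[of t] by (simp add: eq_neg_iff_add_eq_0 add.commute)
    moreover have "eval2 V (f t) t * eval2 T (f t) t + eval2 W (f t) t * eval2 U (f t) t = poly a t"
      using arg_cong[OF VW, of "\<lambda>P. eval2 P (f t) t"] by simp
    ultimately show ?thesis by (simp add: algebra_simps)
  qed
  have "T \<noteq> 0" using T a A1(1) by auto
  have "degree A1 = degree D + degree T"
    using arg_cong[OF T, of degree] a D \<open>T \<noteq> 0\<close> by (simp add: degree_mult_eq)
  then have "\<not> degree A \<le> degree T" using A(1) A1(2) by linarith
  then have "\<not> G T" using min by blast
  moreover have "(\<lambda>t. eval2 V (f t) t - eval2 W (f t) t * deriv f t) holomorphic_on UNIV"
    by (intro holomorphic_intros eval2_holomorphic f(1) df_hol)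
  ultimately have "\<not> 1 \<le> degree T" using inv a unfolding G_def by blast
  then have "degree T = 0" by simp
  then obtain \<tau> where T\<tau>: "T = [:\<tau>:]" by (rule degree_eq_zeroE)
  then have \<tau>: "\<tau> \<noteq> 0" using \<open>T \<noteq> 0\<close> by auto
  have "Polynomial.smult a (Polynomial.smult \<tau> B1) = Polynomial.smult \<tau> (D * U)"
    by (simp add: U[symmetric] mult.commute)
  also have "\<dots> = Polynomial.smult a (A1 * U)"
    using T by (simp add: T\<tau> flip: mult_smult_left)
  finally have AU: "Polynomial.smult \<tau> B1 = A1 * U"
    using a by (metis smult_eq_iff smult_cancel)
  obtain n where n: "degree A = Suc n" using A(1) by (cases "degree A") auto
  have "degree U \<le> 1"
  proof (cases "U = 0")
    case False
    have "degree A1 + degree U = degree (Polynomial.smult \<tau> B1)"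
      using A1(1) False by (simp add: AU degree_mult_eq)
    also have "\<dots> \<le> degree A"
      unfolding B1_def
      by (intro order_trans[OF degree_smult_le] degree_diff_le)
         (auto intro!: order_trans[OF degree_smult_le] degree_le simp: coeff_map_poly coeff_eq_0)
    finally show ?thesis using A1(2) by linarith
  qed simp
  then obtain u0 u1 where u: "U = [:u0, u1:]"
    by (metis degree_0 degree_pCons_eq degree_pCons_eq_if le_zero_eq not_less_eq_eq One_nat_def pCons_cases degree_eq_zeroE pCons_0_0)
  define \<alpha> where "\<alpha> = of_nat (Suc n) * poly.coeff A (Suc n)"
  define \<beta> where "\<beta> = poly.coeff A n"
  have "poly.coeff A (Suc n) \<noteq> 0" using n by (metis A(1) degree_0 leading_coeff_0_iff not_one_le_zero)
  then have \<alpha>: "\<alpha> \<noteq> 0" by (simp add: \<alpha>_def del: of_nat_Suc)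
  have c1: "\<tau> * (\<pi> * pderiv (poly.coeff A (Suc n)) - w * poly.coeff A (Suc n)) = \<pi> * u1 * \<alpha>"
    using arg_cong[OF AU, of "\<lambda>P. poly.coeff P (Suc n)"] n
    by (simp add: A1_def B1_def u \<alpha>_def coeff_map_poly coeff_pderiv coeff_eq_0 algebra_simps)
  have c0: "\<tau> * (\<pi> * pderiv \<beta> - w * \<beta>) = \<pi> * (u0 * \<alpha> + of_nat n * u1 * \<beta>)"
    using arg_cong[OF AU, of "\<lambda>P. poly.coeff P n"] n
    by (cases n) (simp_all add: A1_def B1_def u \<alpha>_def \<beta>_def coeff_map_poly coeff_pderiv algebra_simps)
  have f': "poly \<tau> t * deriv f t = - (poly u0 t + poly u1 t * f t)" for t
  proof -
    have "eval2 A1 (f t) t * (poly \<tau> t * deriv f t + eval2 U (f t) t) = 0" for t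
    proof -
      have "eval2 A1 (f t) t * (poly \<tau> t * deriv f t + eval2 U (f t) t)
        = poly \<tau> t * (eval2 A1 (f t) t * deriv f t) + eval2 (A1 * U) (f t) t" by (simp add: algebra_simps)
      also have "\<dots> = poly \<tau> t * (eval2 A1 (f t) t * deriv f t + eval2 B1 (f t) t)"
        unfolding AU[symmetric] by (simp add: algebra_simps)
      finally show ?thesis by (simp add: ode)
    qed
    moreover obtain t1 where "eval2 A1 (f t1) t1 \<noteq> 0" using A1(1) f(4) unfolding transc_fun_def by blast
    ultimately have "poly \<tau> t * deriv f t + eval2 U (f t) t = 0"
      by (intro entire_mult_eq_0[OF eval2_holomorphic[OF f(1)] _ _ , of "\<lambda>t. poly \<tau> t * deriv f t + eval2 U (f t) t" A1 t1 t])
         (auto intro!: holomorphic_intros eval2_holomorphic f(1) df_hol)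
    then show ?thesis by (simp add: u add_eq_0_iff mult.commute)
  qed
  define \<sigma> where "\<sigma> = \<tau> * \<pi>"
  define \<omega> where "\<omega> = \<tau> * w + of_nat n * \<pi> * u1"
  show ?thesis
  proof (rule that[OF \<alpha>, of \<sigma> \<beta> \<omega>])
    show "\<sigma> \<noteq> 0" using \<tau> \<pi> by (simp add: \<sigma>_def)
    fix t
    let ?g = "\<lambda>t. poly \<alpha> t * f t + poly \<beta> t"
    have "(?g has_field_derivative poly (pderiv \<alpha>) t * f t + poly \<alpha> t * deriv f t + poly (pderiv \<beta>) t) (at t)"
      by (auto intro!: derivative_eq_intros df poly_DERIV simp: algebra_simps)
    then have dg: "deriv ?g t = poly (pderiv \<alpha>) t * f t + poly \<alpha> t * deriv f t + poly (pderiv \<beta>) t"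
      by (rule DERIV_imp_deriv)
    have "\<tau> * \<pi> * pderiv \<alpha> = \<tau> * w * \<alpha> + of_nat (Suc n) * \<pi> * u1 * \<alpha>"
    proof -
      have "pderiv \<alpha> = of_nat (Suc n) * pderiv (poly.coeff A (Suc n))"
        unfolding \<alpha>_def by (simp add: pderiv_mult pderiv_of_nat del: of_nat_Suc)
      then have "\<tau> * \<pi> * pderiv \<alpha> = of_nat (Suc n) * (\<tau> * (\<pi> * pderiv (poly.coeff A (Suc n)) - w * poly.coeff A (Suc n))) + \<tau> * w * \<alpha>"
        by (simp add: \<alpha>_def algebra_simps del: of_nat_Suc)
      then show ?thesis unfolding c1 by (simp add: algebra_simps del: of_nat_Suc)
    qed
    from arg_cong[OF this, of "\<lambda>p. poly p t"]
    have c1': "poly \<tau> t * poly \<pi> t * poly (pderiv \<alpha>) t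
        = poly \<tau> t * poly w t * poly \<alpha> t + (of_nat n + 1) * poly \<pi> t * poly u1 t * poly \<alpha> t"
      by (simp add: algebra_simps)
    from arg_cong[OF c0, of "\<lambda>p. poly p t"]
    have c0': "poly \<tau> t * poly \<pi> t * poly (pderiv \<beta>) t
        = poly \<tau> t * poly w t * poly \<beta> t + poly \<pi> t * (poly u0 t * poly \<alpha> t + of_nat n * poly u1 t * poly \<beta> t)"
      by (simp add: algebra_simps)
    have "poly \<sigma> t * deriv ?g t = (poly \<tau> t * poly \<pi> t * poly (pderiv \<alpha>) t) * f t
        + poly \<pi> t * poly \<alpha> t * (poly \<tau> t * deriv f t) + poly \<tau> t * poly \<pi> t * poly (pderiv \<beta>) t"
      unfolding dg \<sigma>_def by (simp add: algebra_simps)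
    also have "\<dots> = poly \<omega> t * ?g t"
      unfolding c1' c0' f' \<omega>_def by (simp add: algebra_simps)
    finally show "poly \<sigma> t * deriv ?g t = poly \<omega> t * ?g t" .
  qed
qed

theorem affine_power_of_poly_times_exp:
  assumes f: "f holomorphic_on UNIV" "growth N f" "1 \<le> N"
    and h: "h holomorphic_on UNIV" "\<not> h constant_on UNIV" and "q \<noteq> 0"
    and P: "\<And>t. eval2 P (f t) t = poly q t * exp (h t)"
  defines "n \<equiv> degree P" and "l \<equiv> lead_coeff P"
  shows "1 \<le> n \<and> Polynomial.smult ((of_nat n * l) ^ n) P = Polynomial.smult l ([:poly.coeff P (n - 1), of_nat n * l:] ^ n)"
proof -
  note ne = not_algebraic_poly_times_exp[OF h \<open>q \<noteq> 0\<close>]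
  have "\<exists>t. eval2 P (f t) t \<noteq> poly s t" for s using ne[of s] P by simp
  moreover have "eval2 [:s:] (f t) t = poly s t" for s t by simp
  ultimately have "P \<noteq> [:s:]" for s by metis
  then have "degree P \<noteq> 0" by (metis degree_eq_zeroE)
  then have deg: "1 \<le> degree P" by linarith
  have tr: "transc_fun f"
  proof (rule ccontr)
    assume "\<not> transc_fun f"
    then obtain p where "\<And>t. f t = poly p t" using algebraic_entire_imp_poly'[OF f(1)] by blast
    then show False using ne[of "poly P p"] P by (simp add: eval2_poly)
  qed
  have inv: "eval2 P (f t) t * exp (- h t) = poly q t" for t by (simp add: P exp_minus)
  have eh: "(\<lambda>t. exp (- h t)) holomorphic_on UNIV" using h(1) by (intro holomorphic_intros)
  obtain \<alpha> \<beta> \<sigma> \<omega> where "\<alpha> \<noteq> 0" and \<sigma>: "\<sigma> \<noteq> 0"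
    "\<And>t. poly \<sigma> t * deriv (\<lambda>t. poly \<alpha> t * f t + poly \<beta> t) t = poly \<omega> t * (poly \<alpha> t * f t + poly \<beta> t)"
    by (rule linear_differential_equation[OF f tr deg eh inv \<open>q \<noteq> 0\<close>]) (rule that)
  let ?n = "degree P" and ?l = "lead_coeff P"
  let ?g = "\<lambda>t. poly \<alpha> t * f t + poly \<beta> t"
  obtain E where E: "degree E \<le> ?n" "Polynomial.smult (\<alpha> ^ ?n) P = pcompose E [:\<beta>, \<alpha>:]"
    using pcompose_linear_expansion by blast
  have g: "?g holomorphic_on UNIV" "growth N ?g" "transc_fun ?g"
    using f tr \<open>\<alpha> \<noteq> 0\<close> by (auto intro!: holomorphic_intros growth_add growth_mult growth_poly transc_fun_linear)
  have "eval2 E (?g t) t * exp (- h t) = poly (\<alpha> ^ ?n * q) t" for t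
  proof -
    have "eval2 E (?g t) t = poly \<alpha> t ^ ?n * (poly q t * exp (h t))"
      using arg_cong[OF E(2), of "\<lambda>P. eval2 P (f t) t"]
      by (simp add: eval2_pcompose_linear P algebra_simps)
    then show ?thesis by (simp add: exp_minus)
  qed
  then have mono: "i = j" if "poly.coeff E i \<noteq> 0" "poly.coeff E j \<noteq> 0" for i j
    using \<open>\<alpha> \<noteq> 0\<close> \<open>q \<noteq> 0\<close> h(1)
    by (intro single_term_of_poly_divisor[OF g(1,2) f(3) g(3) \<sigma>(1) \<sigma>(2), of "\<lambda>t. exp (- h t)" E "\<alpha> ^ ?n * q"] that)
       (auto intro!: holomorphic_intros)
  have dE: "degree E = ?n"
    using arg_cong[OF E(2), of degree] \<open>\<alpha> \<noteq> 0\<close> by (simp add: degree_pcompose)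
  then have "poly.coeff E ?n \<noteq> 0"
    using deg by (metis degree_0 leading_coeff_0_iff not_one_le_zero)
  then have "poly.coeff E k = (if k = ?n then lead_coeff E else 0)" for k
    using mono dE by metis
  then have "E = Polynomial.monom (lead_coeff E) ?n"
    by (intro poly_eqI) (metis coeff_monom)
  moreover have "pcompose (Polynomial.monom e k) p = Polynomial.smult e (p ^ k)"
    for e :: "complex poly" and p k
    by (induction k) (auto simp: monom_0 monom_Suc pcompose_pCons)
  ultimately have eq: "Polynomial.smult (\<alpha> ^ ?n) P = Polynomial.smult (lead_coeff E) ([:\<beta>, \<alpha>:] ^ ?n)"
    using E(2) by metis
  have "\<alpha> ^ ?n * ?l = \<alpha> ^ ?n * lead_coeff E"
    using arg_cong[OF eq, of "\<lambda>P. poly.coeff P ?n"] by (simp add: coeff_linear_poly_power mult.commute)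
  then have l: "lead_coeff E = ?l" using \<open>\<alpha> \<noteq> 0\<close> by simp
  obtain m where m: "?n = Suc m" using deg by (cases ?n) auto
  have "\<alpha> ^ m * (\<alpha> * poly.coeff P m) = \<alpha> ^ m * (of_nat ?n * ?l * \<beta>)"
  proof -
    have "poly.coeff ([:\<beta>, \<alpha>:] ^ ?n) m = of_nat ?n * \<alpha> ^ m * \<beta>"
      using coeff_linear_poly_power[of m ?n \<beta> \<alpha>] m by (simp del: power_Suc of_nat_Suc)
    then show ?thesis
      using arg_cong[OF eq, of "\<lambda>P. poly.coeff P m"] unfolding l by (simp add: m algebra_simps)
  qed
  then have lin: "\<alpha> * poly.coeff P m = of_nat ?n * ?l * \<beta>"
    using \<open>\<alpha> \<noteq> 0\<close> by simp
  have spow: "Polynomial.smult (c ^ k) (p ^ k) = Polynomial.smult c p ^ k" for c :: "complex poly" and p k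
    by (simp add: smult_power)
  have "Polynomial.smult (\<alpha> ^ ?n) (Polynomial.smult ?l ([:poly.coeff P m, of_nat ?n * ?l:] ^ ?n))
      = Polynomial.smult ?l (Polynomial.smult \<alpha> [:poly.coeff P m, of_nat ?n * ?l:] ^ ?n)"
    by (simp only: spow[symmetric] smult_smult mult.commute)
  also have "Polynomial.smult \<alpha> [:poly.coeff P m, of_nat ?n * ?l:] = Polynomial.smult (of_nat ?n * ?l) [:\<beta>, \<alpha>:]"
    using lin by (simp add: mult.commute)
  also have "Polynomial.smult ?l (Polynomial.smult (of_nat ?n * ?l) [:\<beta>, \<alpha>:] ^ ?n)
      = Polynomial.smult ((of_nat ?n * ?l) ^ ?n) (Polynomial.smult ?l ([:\<beta>, \<alpha>:] ^ ?n))"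
    by (simp only: spow[symmetric] smult_smult mult.commute)
  finally have scaled: "Polynomial.smult (\<alpha> ^ ?n) (Polynomial.smult ?l ([:poly.coeff P m, of_nat ?n * ?l:] ^ ?n))
    = Polynomial.smult (\<alpha> ^ ?n) (Polynomial.smult ((of_nat ?n * ?l) ^ ?n) P)"
    using eq unfolding l by (simp only: smult_smult mult.commute[of "\<alpha> ^ ?n"]) (simp only: smult_smult[symmetric])
  then have "Polynomial.smult ((of_nat ?n * ?l) ^ ?n) P = Polynomial.smult ?l ([:poly.coeff P (?n - 1), of_nat ?n * ?l:] ^ ?n)"
  proof -
    have "?n - 1 = m" using m by simp
    moreover have "X = Y" if "Polynomial.smult (\<alpha> ^ ?n) X = Polynomial.smult (\<alpha> ^ ?n) Y" for X Y
      using that \<open>\<alpha> \<noteq> 0\<close> smult_cancel power_not_zero by blast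
    ultimately show ?thesis using scaled by metis
  qed
  with deg show ?thesis by (simp add: n_def l_def)
qed

section \<open>Polynomial functions on \<open>\<complex>\<^sup>n\<close>\<close>

lemma polynomial_fun_monomial: "polynomial_fun (\<lambda>z. c * (\<Prod>i\<in>UNIV. (z $ i) ^ \<alpha> i))"
  unfolding polynomial_fun_def by (intro exI[of _ "{\<alpha>}"] exI[of _ "\<lambda>_. c"]) simp

lemma polynomial_fun_const: "polynomial_fun (\<lambda>_. c)"
  using polynomial_fun_monomial[of c "\<lambda>_. 0"] by simp

lemma polynomial_fun_coordinate: "polynomial_fun (\<lambda>z. z $ i)"
proof -
  have "(\<Prod>k\<in>UNIV. (z $ k) ^ (if k = i then 1 else 0)) = (\<Prod>k\<in>UNIV. if k = i then z $ k else 1)"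
    for z :: "complex^'a" by (intro prod.cong) auto
  then show ?thesis
    using polynomial_fun_monomial[of 1 "\<lambda>k. if k = i then 1 else 0"] by simp
qed

lemma polynomial_fun_add:
  assumes "polynomial_fun f" "polynomial_fun g"
  shows "polynomial_fun (\<lambda>z. f z + g z)"
proof -
  obtain A c where A: "finite A" "\<And>z. f z = (\<Sum>\<alpha>\<in>A. c \<alpha> * (\<Prod>i\<in>UNIV. (z $ i) ^ \<alpha> i))"
    using assms(1) unfolding polynomial_fun_def by auto
  obtain B d where B: "finite B" "\<And>z. g z = (\<Sum>\<alpha>\<in>B. d \<alpha> * (\<Prod>i\<in>UNIV. (z $ i) ^ \<alpha> i))"
    using assms(2) unfolding polynomial_fun_def by auto
  let ?c = "\<lambda>\<alpha>. if \<alpha> \<in> A then c \<alpha> else 0" and ?d = "\<lambda>\<alpha>. if \<alpha> \<in> B then d \<alpha> else 0"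
  have "f z = (\<Sum>\<alpha>\<in>A \<union> B. ?c \<alpha> * (\<Prod>i\<in>UNIV. (z $ i) ^ \<alpha> i))" for z
    unfolding A(2) using A(1) B(1) by (intro sum.mono_neutral_cong_left) auto
  moreover have "g z = (\<Sum>\<alpha>\<in>A \<union> B. ?d \<alpha> * (\<Prod>i\<in>UNIV. (z $ i) ^ \<alpha> i))" for z
    unfolding B(2) using A(1) B(1) by (intro sum.mono_neutral_cong_left) auto
  ultimately have "f z + g z = (\<Sum>\<alpha>\<in>A \<union> B. (?c \<alpha> + ?d \<alpha>) * (\<Prod>i\<in>UNIV. (z $ i) ^ \<alpha> i))" for z
    by (simp only: distrib_right sum.distrib)
  then show ?thesis
    unfolding polynomial_fun_def using A(1) B(1)
    by (intro exI[of _ "A \<union> B"] exI[of _ "\<lambda>\<alpha>. ?c \<alpha> + ?d \<alpha>"]) blast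
qed

lemma polynomial_fun_sum:
  "(\<And>x. x \<in> X \<Longrightarrow> polynomial_fun (F x)) \<Longrightarrow> polynomial_fun (\<lambda>z. \<Sum>x\<in>X. F x z)"
  by (induction X rule: infinite_finite_induct) (auto intro: polynomial_fun_const polynomial_fun_add)

lemma polynomial_fun_mult:
  assumes "polynomial_fun f" "polynomial_fun g"
  shows "polynomial_fun (\<lambda>z. f z * g z)"
proof -
  obtain A c where A: "\<And>z. f z = (\<Sum>\<alpha>\<in>A. c \<alpha> * (\<Prod>i\<in>UNIV. (z $ i) ^ \<alpha> i))"
    using assms(1) unfolding polynomial_fun_def by auto
  obtain B d where B: "\<And>z. g z = (\<Sum>\<alpha>\<in>B. d \<alpha> * (\<Prod>i\<in>UNIV. (z $ i) ^ \<alpha> i))"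
    using assms(2) unfolding polynomial_fun_def by auto
  have "f z * g z = (\<Sum>\<alpha>\<in>A. \<Sum>\<beta>\<in>B. (c \<alpha> * d \<beta>) * (\<Prod>i\<in>UNIV. (z $ i) ^ (\<alpha> i + \<beta> i)))" for z
    unfolding A B sum_product by (intro sum.cong refl) (simp add: power_add prod.distrib)
  then show ?thesis
    by (simp only: polynomial_fun_sum polynomial_fun_monomial)
qed

lemma polynomial_fun_prod:
  "(\<And>x. x \<in> X \<Longrightarrow> polynomial_fun (F x)) \<Longrightarrow> polynomial_fun (\<lambda>z. \<Prod>x\<in>X. F x z)"
  by (induction X rule: infinite_finite_induct) (auto intro: polynomial_fun_const polynomial_fun_mult)

lemma polynomial_fun_line:
  fixes f :: "complex^'n::finite \<Rightarrow> complex"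
  assumes "polynomial_fun f"
  obtains d where "\<And>a b. \<exists>s. degree s \<le> d \<and> (\<forall>t. f (a + t *s b) = poly s t)"
proof -
  obtain A c where A: "finite A" "\<And>z. f z = (\<Sum>\<alpha>\<in>A. c \<alpha> * (\<Prod>i\<in>UNIV. (z $ i) ^ \<alpha> i))"
    using assms unfolding polynomial_fun_def by auto
  define d where "d = (\<Sum>\<alpha>\<in>A. \<Sum>i\<in>UNIV. \<alpha> i)"
  have "\<exists>s. degree s \<le> d \<and> (\<forall>t. f (a + t *s b) = poly s t)" for a b
  proof (intro exI conjI allI)
    let ?s = "\<Sum>\<alpha>\<in>A. Polynomial.smult (c \<alpha>) (\<Prod>i\<in>UNIV. [:a $ i, b $ i:] ^ \<alpha> i)"
    show "degree ?s \<le> d"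
    proof (rule degree_sum_le[OF A(1)])
      fix \<alpha> assume "\<alpha> \<in> A"
      have "degree (\<Prod>i\<in>UNIV. [:a $ i, b $ i:] ^ \<alpha> i) \<le> (\<Sum>i\<in>UNIV. degree ([:a $ i, b $ i:] ^ \<alpha> i))"
        using degree_prod_sum_le[of UNIV "\<lambda>i. [:a $ i, b $ i:] ^ \<alpha> i"] by (simp add: o_def)
      also have "\<dots> \<le> (\<Sum>i\<in>UNIV. \<alpha> i)"
        by (intro sum_mono order_trans[OF degree_power_le]) auto
      also have "\<dots> \<le> d" unfolding d_def using A(1) \<open>\<alpha> \<in> A\<close> by (intro member_le_sum) auto
      finally show "degree (Polynomial.smult (c \<alpha>) (\<Prod>i\<in>UNIV. [:a $ i, b $ i:] ^ \<alpha> i)) \<le> d"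
        by (rule order_trans[OF degree_smult_le])
    qed
    show "f (a + t *s b) = poly ?s t" for t
      by (simp add: A(2) poly_sum poly_prod)
  qed
  then show ?thesis using that by blast
qed

lemma ev_simps [simp]:
  "ev 0 z = 0" "ev 1 z = 1" "ev (f + g) z = ev f z + ev g z" "ev (f - g) z = ev f z - ev g z"
  "ev (- f) z = - ev f z" "ev (f * g) z = ev f z * ev g z"
  "ev (const_entire c) z = c" "ev (exp_entire f) z = exp (ev f z)"
  by (simp_all add: zero_entire.rep_eq one_entire.rep_eq plus_entire.rep_eq minus_entire.rep_eq
      uminus_entire.rep_eq times_entire.rep_eq const_entire.rep_eq exp_entire.rep_eq)

lemma ev_power [simp]: "ev (f ^ n) z = ev f z ^ n"
  by (induction n) auto

lemma ev_of_nat [simp]: "ev (of_nat n) z = of_nat n"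
  by (induction n) auto

lemma entire_eqI: "(\<And>z. ev f z = ev g z) \<Longrightarrow> f = g"
  by (metis ev_inject ext)

lemma ev_nonzeroE:
  assumes "f \<noteq> 0" obtains a where "ev f a \<noteq> 0"
  using assms entire_eqI[of f 0] by auto

lemma ev_holomorphic_on_line: "(\<lambda>t. ev f (a + t *s b)) holomorphic_on UNIV"
  using entire_fun_line_holomorphic ev by blast

lemma Polys_closed [simp, intro]:
  "0 \<in> Polys" "1 \<in> Polys" "const_entire c \<in> Polys" "of_nat n \<in> Polys"
  "f \<in> Polys \<Longrightarrow> g \<in> Polys \<Longrightarrow> f + g \<in> Polys"
  "f \<in> Polys \<Longrightarrow> g \<in> Polys \<Longrightarrow> f * g \<in> Polys"
  by (simp_all add: Polys_def ev_simps[abs_def] ev_of_nat[abs_def]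
      polynomial_fun_const polynomial_fun_add polynomial_fun_mult)

lemma Polys_uminus [simp, intro]: "f \<in> Polys \<Longrightarrow> - f \<in> Polys"
  using entire_eqI[of "const_entire (-1) * f" "- f"] Polys_closed(3,6)
  by (metis ev_simps(5,6,7) mult_minus1)

lemma Polys_power [simp, intro]: "f \<in> Polys \<Longrightarrow> f ^ n \<in> Polys"
  by (induction n) auto

lemma Polys_sum: "(\<And>x. x \<in> X \<Longrightarrow> F x \<in> Polys) \<Longrightarrow> sum F X \<in> Polys"
  by (induction X rule: infinite_finite_induct) auto

lemma Polys_line:
  assumes "f \<in> Polys"
  obtains d where "\<And>a b. \<exists>s. degree s \<le> d \<and> (\<forall>t. ev f (a + t *s b) = poly s t)"
  using assms polynomial_fun_line[of "ev f"] unfolding Polys_def by blast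

section \<open>Polynomiality on lines\<close>

definition lagrange :: "nat \<Rightarrow> nat \<Rightarrow> complex poly" where
  "lagrange N j = (\<Prod>k\<in>{..N} - {j}. Polynomial.smult (1 / (of_nat j - of_nat k)) [:- of_nat k, 1:])"

lemma poly_lagrange_of_nat:
  assumes "i \<le> N"
  shows "poly (lagrange N j) (of_nat i) = (if i = j then 1 else 0)"
proof (cases "i = j")
  case True
  have "poly (lagrange N j) (of_nat i) = (\<Prod>k\<in>{..N} - {j}. 1)"
    unfolding lagrange_def poly_prod using True by (intro prod.cong) (auto simp: divide_simps)
  then show ?thesis using True by simp
next
  case False
  then show ?thesis
    unfolding lagrange_def poly_prod using assms by (auto intro!: prod_zero bexI[of _ i])
qed

lemma lagrange_interpolation:
  fixes s :: "complex poly"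
  assumes "degree s \<le> N"
  shows "poly s x = (\<Sum>j\<le>N. poly (lagrange N j) x * poly s (of_nat j))"
proof -
  let ?r = "\<Sum>j\<le>N. Polynomial.smult (poly s (of_nat j)) (lagrange N j)"
  have deg: "degree (lagrange N j) \<le> N" if "j \<le> N" for j
  proof -
    have "degree (lagrange N j) \<le> (\<Sum>k\<in>{..N} - {j}. degree (Polynomial.smult (1 / (of_nat j - of_nat k :: complex)) [:- of_nat k, 1:]))"
      unfolding lagrange_def
      using degree_prod_sum_le[of "{..N} - {j}" "\<lambda>k. Polynomial.smult (1 / (of_nat j - of_nat k :: complex)) [:- of_nat k, 1:]"]
      by (simp add: o_def)
    also have "\<dots> \<le> (\<Sum>k\<in>{..N} - {j}. 1)"
      by (intro sum_mono order_trans[OF degree_smult_le]) auto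
    also have "\<dots> = N" using that by (simp add: card_Diff_subset)
    finally show ?thesis .
  qed
  have "s = ?r"
  proof (rule poly_eqI_degree[of "of_nat ` {..N}"])
    fix x :: complex assume "x \<in> of_nat ` {..N}"
    then obtain i where i: "i \<le> N" "x = of_nat i" by auto
    have "poly ?r x = (\<Sum>j\<le>N. if i = j then poly s (of_nat j) else 0)"
      unfolding poly_sum i(2) using poly_lagrange_of_nat[OF i(1)] by (intro sum.cong) auto
    then show "poly s x = poly ?r x" using i by simp
  next
    have "card (of_nat ` {..N} :: complex set) = Suc N"
      by (subst card_image) (auto simp: inj_on_def)
    moreover have "degree ?r \<le> N"
      using deg by (intro degree_sum_le) (auto intro: order_trans[OF degree_smult_le])
    ultimately show "degree s < card (of_nat ` {..N} :: complex set)" "degree ?r < card (of_nat ` {..N} :: complex set)"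
      using assms by auto
  qed
  then have "poly s x = poly ?r x" by (rule arg_cong)
  then show ?thesis by (simp add: poly_sum mult.commute)
qed

definition vupd :: "complex^'n \<Rightarrow> 'n \<Rightarrow> complex \<Rightarrow> complex^'n" where
  "vupd z i x = (\<chi> k. if k = i then x else z $ k)"

lemma vupd_nth [simp]: "vupd z i x $ k = (if k = i then x else z $ k)"
  by (simp add: vupd_def)

lemma polynomial_fun_of_interpolation:
  fixes u :: "complex^'n::finite \<Rightarrow> complex"
  assumes "\<And>i z. u z = (\<Sum>j\<le>N. poly (lagrange N j) (z $ i) * u (vupd z i (of_nat j)))"
  shows "polynomial_fun u"
proof -
  have "polynomial_fun u" if "finite I" "\<And>z z'. (\<And>k. k \<in> I \<Longrightarrow> z $ k = z' $ k) \<Longrightarrow> u z = u z'"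
    "\<And>i z. i \<in> I \<Longrightarrow> u z = (\<Sum>j\<le>N. poly (lagrange N j) (z $ i) * u (vupd z i (of_nat j)))" for I and u :: "complex^'n \<Rightarrow> complex"
    using that
  proof (induction I arbitrary: u)
    case empty
    then have "u = (\<lambda>_. u 0)" by blast
    then show ?case by (metis polynomial_fun_const)
  next
    case (insert i I)
    have lag: "polynomial_fun (\<lambda>z. poly (lagrange N j) (z $ i))" for j
    proof -
      have "polynomial_fun (\<lambda>z. \<Prod>k\<in>{..N} - {j}. 1 / (of_nat j - of_nat k) * (z $ i + - of_nat k))"
        by (intro polynomial_fun_prod polynomial_fun_mult polynomial_fun_add
            polynomial_fun_coordinate polynomial_fun_const)
      then show ?thesis
        by (simp add: lagrange_def poly_prod diff_divide_distrib)
    qed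
    have "polynomial_fun (\<lambda>z. u (vupd z i (of_nat j)))" for j
    proof (rule insert.IH)
      show "u (vupd z i (of_nat j)) = u (vupd z' i (of_nat j))" if "\<And>k. k \<in> I \<Longrightarrow> z $ k = z' $ k" for z z'
        using that by (intro insert.prems(1)) auto
      show "u (vupd z i (of_nat j)) = (\<Sum>l\<le>N. poly (lagrange N l) (z $ i') * u (vupd (vupd z i' (of_nat l)) i (of_nat j)))"
        if "i' \<in> I" for i' z
      proof -
        have "i' \<noteq> i" using that insert.hyps by auto
        then have "vupd (vupd z i' x) i y = vupd (vupd z i y) i' x" for x y by (auto simp: vec_eq_iff)
        then show ?thesis
          using insert.prems(2)[of i' "vupd z i (of_nat j)"] that \<open>i' \<noteq> i\<close> by simp
      qed
    qed
    then have "polynomial_fun (\<lambda>z. \<Sum>j\<le>N. poly (lagrange N j) (z $ i) * u (vupd z i (of_nat j)))"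
      by (intro polynomial_fun_sum polynomial_fun_mult lag)
    moreover have "u = (\<lambda>z. \<Sum>j\<le>N. poly (lagrange N j) (z $ i) * u (vupd z i (of_nat j)))"
      using insert.prems(2)[of i] by blast
    ultimately show ?case by metis
  qed
  note * = this
  show ?thesis
  proof (rule *[of UNIV u])
    show "u z = u z'" if "\<And>k. k \<in> UNIV \<Longrightarrow> z $ k = z' $ k" for z z'
      using that by (metis UNIV_I vec_eq_iff)
  qed (simp, rule assms)
qed

text \<open>On a line through \<open>a\<close> with \<open>Q a \<noteq> 0\<close> Lagrange interpolation is valid; it extends to all
  of \<open>\<complex>\<^sup>n\<close> since \<open>{Q \<noteq> 0}\<close> is dense in every line that meets it.\<close>

lemma Polys_of_poly_on_lines:
  fixes u Q :: "'n::finite entire"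
  assumes "Q \<in> Polys" "Q \<noteq> 0"
    and lines: "\<And>a b. ev Q a \<noteq> 0 \<Longrightarrow> \<exists>s. degree s \<le> N \<and> (\<forall>t. ev u (a + t *s b) = poly s t)"
  shows "u \<in> Polys"
proof -
  let ?R = "\<lambda>i z. \<Sum>j\<le>N. poly (lagrange N j) (z $ i) * ev u (vupd z i (of_nat j))"
  have generic: "ev u z = ?R i z" if nz: "ev Q z \<noteq> 0" for i z
  proof -
    obtain s where s: "degree s \<le> N" "\<And>t. ev u (z + t *s axis i 1) = poly s t"
      using lines[OF nz] by blast
    have line: "z + (x - z $ i) *s axis i 1 = vupd z i x" for x
      by (auto simp: vec_eq_iff axis_def)
    define r where "r = pcompose s [:- z $ i, 1:]"
    have r: "degree r \<le> N" "poly r x = ev u (vupd z i x)" for x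
      using s(1) s(2)[of "x - z $ i", unfolded line] by (auto simp: r_def degree_pcompose poly_pcompose)
    have "vupd z i (z $ i) = z" by (simp add: vec_eq_iff)
    then show ?thesis using lagrange_interpolation[OF r(1), of "z $ i"] by (simp add: r(2))
  qed
  have "ev u z = ?R i z" for i z
  proof -
    obtain a where a: "ev Q a \<noteq> 0" using \<open>Q \<noteq> 0\<close> by (rule ev_nonzeroE)
    obtain s where s: "\<And>t. ev Q (z + t *s (a - z)) = poly s t" using Polys_line[OF \<open>Q \<in> Polys\<close>] by metis
    have "s \<noteq> 0" using s[of 1] a by auto
    have upd: "vupd (z + t *s b) i x = vupd z i x + t *s vupd b i 0" for t b x
      by (auto simp: vec_eq_iff)
    have cont: "continuous_on UNIV (\<lambda>t. ev u (a + t *s b))" for a b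
      by (intro holomorphic_on_imp_continuous_on ev_holomorphic_on_line)
    have "ev u (z + t *s (a - z)) = ?R i (z + t *s (a - z))" for t
    proof (rule eq_of_poly_mult_eq[of "\<lambda>t. ev u (z + t *s (a - z))" "\<lambda>t. ?R i (z + t *s (a - z))", OF _ _ \<open>s \<noteq> 0\<close>])
      show "continuous_on UNIV (\<lambda>t. ev u (z + t *s (a - z)))" by (rule cont)
      show "continuous_on UNIV (\<lambda>t. ?R i (z + t *s (a - z)))"
        unfolding upd vector_add_component vector_smult_component by (intro continuous_intros cont)
      show "poly s t * ev u (z + t *s (a - z)) = poly s t * ?R i (z + t *s (a - z))" for t
        using generic[of "z + t *s (a - z)" i] s[of t] by force
    qed
    from this[of 0] show ?thesis by simp
  qed
  then have "polynomial_fun (ev u)" by (rule polynomial_fun_of_interpolation)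
  then show ?thesis by (simp add: Polys_def)
qed

definition line_poly :: "complex^'n::finite \<Rightarrow> complex^'n \<Rightarrow> 'n entire \<Rightarrow> complex poly" where
  "line_poly a b u = (SOME s. \<forall>t. poly s t = ev u (a + t *s b))"

lemma poly_line_poly:
  assumes "u \<in> Polys"
  shows "poly (line_poly a b u) t = ev u (a + t *s b)"
proof -
  have "\<exists>s. \<forall>t. poly s t = ev u (a + t *s b)" using Polys_line[OF assms] by metis
  then have "\<forall>t. poly (line_poly a b u) t = ev u (a + t *s b)" unfolding line_poly_def by (rule someI_ex)
  then show ?thesis by simp
qed

lemma line_poly_0 [simp]: "line_poly a b 0 = 0"
  using poly_line_poly[of 0 a b] by (intro poly_ext) simp

lemma degree_line_poly_le:
  assumes "u \<in> Polys"
  obtains d where "\<And>a b. degree (line_poly a b u) \<le> d"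
proof -
  obtain d where d: "\<And>a b. \<exists>s. degree s \<le> d \<and> (\<forall>t. ev u (a + t *s b) = poly s t)"
    using Polys_line[OF assms] by metis
  have "degree (line_poly a b u) \<le> d" for a b
  proof -
    obtain s where s: "degree s \<le> d" "\<And>t. ev u (a + t *s b) = poly s t" using d by blast
    then have "line_poly a b u = s" by (intro poly_ext) (simp add: poly_line_poly[OF assms])
    then show ?thesis using s by simp
  qed
  then show ?thesis using that by blast
qed

lemma eval2_line_poly:
  assumes "\<And>i. poly.coeff P i \<in> Polys"
  shows "eval2 (map_poly (line_poly a b) P) (ev f (a + t *s b)) t = ev (poly P f) (a + t *s b)"
  using assms
proof (induction P)
  case (pCons c P)
  have "c \<in> Polys" using pCons.prems[of 0] by simp
  moreover have "poly.coeff P i \<in> Polys" for i using pCons.prems[of "Suc i"] by simp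
  ultimately show ?case using pCons.IH by (simp add: map_poly_pCons poly_line_poly)
qed simp

lemma norm_scaleC: "norm (c *s b) = norm c * norm b" for b :: "complex^'n::finite"
  by (simp add: norm_vec_def norm_mult L2_set_right_distrib)

lemma finite_order_imp_growth_on_lines:
  assumes "finite_order f"
  obtains N where "1 \<le> N" "\<And>a b. growth N (\<lambda>t. ev f (a + t *s b))"
proof -
  obtain C \<rho> where C: "C > 0" "\<rho> > 0" "\<And>z. norm (ev f z) \<le> C * exp (norm z powr \<rho>)"
    using assms unfolding finite_order_def by blast
  define N where "N = nat \<lceil>\<rho>\<rceil>"
  have N: "1 \<le> N" "\<rho> \<le> real N" using C(2) by (auto simp: N_def) linarith+
  have "growth N (\<lambda>t. ev f (a + t *s b))" for a b
  proof -
    define M where "M = 1 + norm a + norm b"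
    have "norm (ev f (a + t *s b)) \<le> exp ((\<bar>ln C\<bar> + M ^ N) * (1 + norm t) ^ N)" for t
    proof -
      let ?x = "1 + norm t"
      have "norm (a + t *s b) \<le> norm a + norm t * norm b"
        using norm_triangle_ineq[of a "t *s b"] by (simp add: norm_scaleC)
      also have "\<dots> \<le> M * ?x" by (simp add: M_def algebra_simps)
      finally have le: "norm (a + t *s b) \<le> M * ?x" .
      have "1 \<le> M * ?x" using mult_mono[of 1 M 1 ?x] by (simp add: M_def)
      have "norm (a + t *s b) powr \<rho> \<le> (M * ?x) powr \<rho>"
        using le C(2) by (intro powr_mono2) auto
      also have "\<dots> \<le> (M * ?x) powr real N" using N(2) \<open>1 \<le> M * ?x\<close> by (rule powr_mono)
      also have "\<dots> = (M * ?x) ^ N" using \<open>1 \<le> M * ?x\<close> by (intro powr_realpow) auto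
      finally have "norm (a + t *s b) powr \<rho> \<le> M ^ N * ?x ^ N" by (simp add: power_mult_distrib)
      moreover have "ln C \<le> \<bar>ln C\<bar> * ?x ^ N"
        using mult_left_mono[of 1 "?x ^ N" "\<bar>ln C\<bar>"] by simp
      ultimately have "exp (ln C + norm (a + t *s b) powr \<rho>) \<le> exp ((\<bar>ln C\<bar> + M ^ N) * ?x ^ N)"
        by (simp add: algebra_simps)
      then show ?thesis using C(3)[of "a + t *s b"] C(1) by (simp add: exp_add)
    qed
    then show ?thesis unfolding growth_def by blast
  qed
  then show ?thesis using that N(1) by blast
qed

lemma nonconstant_on_line:
  assumes "\<nexists>c. h = const_entire c"
  obtains b where "\<not> (\<lambda>t. ev h (a + t *s b)) constant_on UNIV"
proof -
  obtain z where z: "ev h z \<noteq> ev h a"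
    using assms entire_eqI[of h "const_entire (ev h a)"] by auto
  have "\<not> (\<lambda>t. ev h (a + t *s (z - a))) constant_on UNIV"
  proof
    assume "(\<lambda>t. ev h (a + t *s (z - a))) constant_on UNIV"
    then obtain c where c: "\<And>t. ev h (a + t *s (z - a)) = c" by (auto simp: constant_on_def)
    show False using c[of 0] c[of 1] z by simp
  qed
  then show ?thesis using that by blast
qed

section \<open>Entire functions algebraic over the polynomials\<close>

lemma Polys_of_power_eq:
  assumes "l \<in> Polys" "l \<noteq> 0" "s \<in> Polys" "1 \<le> n" and eq: "l * v ^ n = s"
  shows "v \<in> Polys"
proof -
  obtain d where d: "\<And>a b. degree (line_poly a b l) \<le> d" using degree_line_poly_le[OF \<open>l \<in> Polys\<close>] by metis
  obtain e where e: "\<And>a b. degree (line_poly a b s) \<le> e" using degree_line_poly_le[OF \<open>s \<in> Polys\<close>] by metis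
  show ?thesis
  proof (rule Polys_of_poly_on_lines[OF assms(1,2), of "max d e"])
    fix a b assume a: "ev l a \<noteq> 0"
    define D where "D = Polynomial.monom (line_poly a b l) n - [:line_poly a b s:]"
    have "poly (line_poly a b l) 0 \<noteq> 0" using a by (simp add: poly_line_poly assms(1))
    then have "line_poly a b l \<noteq> 0" by auto
    then have "poly.coeff D n \<noteq> 0" using \<open>1 \<le> n\<close> by (simp add: D_def coeff_pCons split: nat.split)
    then have "D \<noteq> 0" by auto
    moreover have "eval2 D (ev v (a + t *s b)) t = 0" for t
      using arg_cong[OF eq, of "\<lambda>u. ev u (a + t *s b)"]
      by (simp add: D_def eval2_def poly_monom poly_line_poly assms(1,3))
    moreover have "degree (poly.coeff D i) \<le> max d e" for i
      using d[of a b] e[of a b] \<open>1 \<le> n\<close>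
      by (cases "i = n"; cases i) (auto simp: D_def coeff_pCons le_max_iff_disj intro: degree_diff_le)
    ultimately show "\<exists>p. degree p \<le> max d e \<and> (\<forall>t. ev v (a + t *s b) = poly p t)"
      using algebraic_entire_imp_poly[OF ev_holomorphic_on_line] by metis
  qed
qed

lemma Polys_of_growth_poly_times_exp:
  assumes "q \<in> Polys" "q \<noteq> 0" and growth: "\<And>a b. growth N (\<lambda>t. ev (q * exp_entire h) (a + t *s b))"
  shows "h \<in> Polys"
proof (rule Polys_of_poly_on_lines[OF assms(1,2), of N])
  fix a b assume a: "ev q a \<noteq> 0"
  have "poly (line_poly a b q) 0 \<noteq> 0" using a by (simp add: poly_line_poly assms(1))
  then have "line_poly a b q \<noteq> 0" by auto
  moreover have "growth N (\<lambda>t. poly (line_poly a b q) t * exp (ev h (a + t *s b)))"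
    using growth[of a b] by (simp add: poly_line_poly assms(1))
  ultimately show "\<exists>p. degree p \<le> N \<and> (\<forall>t. ev h (a + t *s b) = poly p t)"
    using growth_poly_mult_exp_imp_poly[OF ev_holomorphic_on_line] by metis
qed

text \<open>Complete the power in \<open>P(f) = q e\<^sup>h\<close> on every line and evaluate at the base point.\<close>

lemma affine_form_of_poly_times_exp:
  fixes f h q :: "'n::finite entire"
  assumes f: "1 \<le> N" "\<And>a b. growth N (\<lambda>t. ev f (a + t *s b))"
    and P: "\<And>i. poly.coeff P i \<in> Polys" and q: "q \<in> Polys" "q \<noteq> 0"
    and h: "\<nexists>c. h = const_entire c" and eq: "poly P f = q * exp_entire h"
  obtains \<alpha> \<beta> v p where "\<alpha> \<in> Polys" "\<beta> \<in> Polys" "v \<in> Polys" "p \<in> Polys" "\<alpha> \<noteq> 0"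
    "\<alpha> * f + \<beta> = v * exp_entire p"
proof -
  define n where "n = degree P"
  define l where "l = lead_coeff P"
  have "exp_entire h \<noteq> 0"
    using ev_simps(8)[of h 0] ev_simps(1) exp_not_eq_zero by metis
  then have "P \<noteq> 0" using eq q(2) by auto
  then have l: "l \<noteq> 0" "l \<in> Polys" using P by (auto simp: l_def)
  define G where "G = poly.coeff P (n - 1) + of_nat n * l * f"
  have key: "1 \<le> n \<and> ev ((of_nat n * l) ^ n * (q * exp_entire h)) a = ev (l * G ^ n) a"
    if a: "ev (l * q) a \<noteq> 0" for a
  proof -
    obtain b where b: "\<not> (\<lambda>t. ev h (a + t *s b)) constant_on UNIV"
      using nonconstant_on_line[OF h] by metis
    let ?lp = "line_poly a b"
    let ?P = "map_poly ?lp P"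
    have at_a: "poly (?lp u) 0 = ev u a" if "u \<in> Polys" for u using poly_line_poly[OF that, of a b 0] by simp
    have "?lp q \<noteq> 0" "?lp l \<noteq> 0" using a at_a[OF q(1)] at_a[OF l(2)] by auto
    then have deg: "degree ?P = n" unfolding n_def l_def by (intro map_poly_degree_eq) auto
    have coeff: "poly.coeff ?P i = ?lp (poly.coeff P i)" for i by (simp add: coeff_map_poly)
    have "eval2 ?P (ev f (a + t *s b)) t = poly (?lp q) t * exp (ev h (a + t *s b))" for t
      using eval2_line_poly[OF P, of a b f t] by (simp add: eq poly_line_poly q(1))
    from affine_power_of_poly_times_exp[OF ev_holomorphic_on_line f(2,1) ev_holomorphic_on_line b \<open>?lp q \<noteq> 0\<close> this]
    have n: "1 \<le> n" and id: "Polynomial.smult ((of_nat n * ?lp l) ^ n) ?P =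
        Polynomial.smult (?lp l) ([:?lp (poly.coeff P (n - 1)), of_nat n * ?lp l:] ^ n)"
      unfolding deg coeff by (auto simp: n_def l_def)
    have "eval2 ?P (ev f a) 0 = ev (q * exp_entire h) a"
      using eval2_line_poly[OF P, of a b f 0] by (simp add: eq)
    with arg_cong[OF id, of "\<lambda>p. eval2 p (ev f a) 0"] n show ?thesis
      by (simp add: at_a l P G_def mult_ac)
  qed
  obtain a where "ev (l * q) a \<noteq> 0" using l q ev_nonzeroE[of "l * q"] by auto
  with key have n: "1 \<le> n" by blast
  have "(l * q) * ((of_nat n * l) ^ n * (q * exp_entire h) - l * G ^ n) = 0"
    using key by (intro entire_eqI) force
  then have power: "(of_nat n * l) ^ n * (q * exp_entire h) = l * G ^ n"
    using l q by simp
  define p where "p = const_entire (1 / of_nat n) * h"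
  define v where "v = G * exp_entire (- p)"
  have "h \<in> Polys"
  proof (rule Polys_of_growth_poly_times_exp[OF q])
    fix a b
    show "growth N (\<lambda>t. ev (q * exp_entire h) (a + t *s b))"
      using eval2_growth[OF f(2,1), of "map_poly (line_poly a b) P" a b]
      by (simp add: eval2_line_poly P eq)
  qed
  then have p: "p \<in> Polys" by (simp add: p_def)
  have inv: "exp_entire h * exp_entire (- p) ^ n = 1"
    using n by (intro entire_eqI) (simp add: p_def exp_minus power_inverse exp_of_nat_mult[symmetric])
  have "l * v ^ n = (l * G ^ n) * exp_entire (- p) ^ n"
    by (simp add: v_def power_mult_distrib mult.assoc)
  also have "\<dots> = (of_nat n * l) ^ n * q * (exp_entire h * exp_entire (- p) ^ n)"
    unfolding power[symmetric] by (simp only: mult_ac)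
  finally have "l * v ^ n = (of_nat n * l) ^ n * q" by (simp only: inv mult_1_right)
  then have v: "v \<in> Polys"
    by (rule Polys_of_power_eq[OF l(2,1) _ n, rotated]) (intro Polys_closed Polys_power l q)
  have "of_nat n * l * f + poly.coeff P (n - 1) = v * exp_entire p"
  proof -
    have "exp_entire (- p) * exp_entire p = 1" by (intro entire_eqI) (simp add: exp_minus)
    then show ?thesis by (simp add: v_def G_def mult.assoc add.commute)
  qed
  moreover have "of_nat n * l \<noteq> 0"
  proof -
    have "ev (of_nat n :: 'n entire) 0 \<noteq> 0" using n by simp
    then have "of_nat n \<noteq> (0 :: 'n entire)" by (metis ev_simps(1))
    then show ?thesis using l by simp
  qed
  ultimately show ?thesis
    using that[OF Polys_closed(6)[OF Polys_closed(4) l(2)] P v p] by blast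
qed

lemma growth_exp_poly: "growth (degree p) (\<lambda>t. exp (poly p t))"
proof -
  have "norm (exp (poly p t)) \<le> exp ((\<Sum>i\<le>degree p. norm (poly.coeff p i)) * (1 + norm t) ^ degree p)" for t
  proof -
    have "norm (poly p t) \<le> (\<Sum>i\<le>degree p. norm (poly.coeff p i * t ^ i))"
      unfolding poly_altdef by (rule norm_sum)
    also have "\<dots> \<le> (\<Sum>i\<le>degree p. norm (poly.coeff p i) * (1 + norm t) ^ degree p)"
      unfolding norm_mult norm_power
      by (intro sum_mono mult_left_mono order_trans[OF power_mono power_increasing]) auto
    finally show ?thesis using complex_Re_le_cmod[of "poly p t"] by (simp add: sum_distrib_right)
  qed
  then show ?thesis unfolding growth_def by blast
qed

lemma constant_on_pderiv_0: "pderiv p = 0 \<Longrightarrow> poly p constant_on UNIV" for p :: "complex poly"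
  by (auto simp: pderiv_eq_0_iff constant_on_def elim!: degree_eq_zeroE)

lemma single_term_of_poly_divisor_exp:
  fixes p :: "'n::finite entire"
  assumes p: "p \<in> Polys" "\<nexists>c. p = const_entire c" and P: "\<And>i. poly.coeff P i \<in> Polys"
    and Q: "Q \<in> Polys" "Q \<noteq> 0" and eq: "poly P (exp_entire p) * h2 = Q" and "i \<noteq> j"
  shows "poly.coeff P i * poly.coeff P j = 0"
proof -
  have "ev (poly.coeff P i) a * ev (poly.coeff P j) a = 0" if a: "ev Q a \<noteq> 0" for a
  proof (rule ccontr)
    assume ne: "ev (poly.coeff P i) a * ev (poly.coeff P j) a \<noteq> 0"
    obtain b where b: "\<not> (\<lambda>t. ev p (a + t *s b)) constant_on UNIV"
      using nonconstant_on_line[OF p(2)] by metis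
    let ?lp = "line_poly a b"
    let ?P = "map_poly ?lp P"
    have at_a: "poly (?lp u) 0 = ev u a" if "u \<in> Polys" for u using poly_line_poly[OF that, of a b 0] by simp
    define g where "g = (\<lambda>t. exp (poly (?lp p) t))"
    define N where "N = degree (?lp p)"
    have g: "g = (\<lambda>t. ev (exp_entire p) (a + t *s b))" by (simp add: g_def poly_line_poly p)
    have "N \<noteq> 0"
      using b constant_on_pderiv_0[of "?lp p"] by (auto simp: N_def pderiv_eq_0_iff poly_line_poly[OF p(1), abs_def])
    have hol: "g holomorphic_on UNIV" unfolding g by (rule ev_holomorphic_on_line)
    have tr: "transc_fun g" unfolding g_def
      using b by (intro transc_fun_exp) (auto simp: poly_line_poly[OF p(1), abs_def] ev_holomorphic_on_line)
    have "i = j"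
    proof (rule single_term_of_poly_divisor[OF hol _ _ tr, of N 1 "pderiv (?lp p)" "\<lambda>t. ev h2 (a + t *s b)" ?P "?lp Q"])
      show "growth N g" unfolding g_def N_def by (rule growth_exp_poly)
      have "(g has_field_derivative exp (poly (?lp p) t) * poly (pderiv (?lp p)) t) (at t)" for t
        unfolding g_def by (auto intro!: derivative_eq_intros poly_DERIV)
      then have "deriv g t = exp (poly (?lp p) t) * poly (pderiv (?lp p)) t" for t
        by (rule DERIV_imp_deriv)
      then show "poly 1 t * deriv g t = poly (pderiv (?lp p)) t * g t" for t by (simp add: g_def)
      show "eval2 ?P (g t) t * ev h2 (a + t *s b) = poly (?lp Q) t" for t
        unfolding g eval2_line_poly[OF P] using arg_cong[OF eq, of "\<lambda>u. ev u (a + t *s b)"]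
        by (simp add: poly_line_poly Q)
      show "?lp Q \<noteq> 0" using at_a[OF Q(1)] a by auto
      show "poly.coeff ?P i \<noteq> 0" "poly.coeff ?P j \<noteq> 0"
        using at_a[OF P[of i]] at_a[OF P[of j]] ne by (auto simp: coeff_map_poly)
    qed (use \<open>N \<noteq> 0\<close> in \<open>auto simp: ev_holomorphic_on_line\<close>)
    then show False using \<open>i \<noteq> j\<close> by simp
  qed
  then have "Q * (poly.coeff P i * poly.coeff P j) = 0" by (intro entire_eqI) force
  then show ?thesis using Q(2) by simp
qed

section \<open>The algebra \<open>\<R>\<^sup>n[f]\<close>\<close>

definition quotient_form :: "'n::finite entire \<Rightarrow> 'n entire fract set" where
  "quotient_form f = {to_fract (poly P f) / to_fract q | P q. (\<forall>i. poly.coeff P i \<in> Polys) \<and> q \<in> Polys \<and> q \<noteq> 0}"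

lemma quotient_formI:
  "(\<And>i. poly.coeff P i \<in> Polys) \<Longrightarrow> q \<in> Polys \<Longrightarrow> q \<noteq> 0 \<Longrightarrow> to_fract (poly P f) / to_fract q \<in> quotient_form f"
  unfolding quotient_form_def by blast

lemma coeff_mult_Polys:
  "(\<And>i. poly.coeff P i \<in> Polys) \<Longrightarrow> (\<And>i. poly.coeff R i \<in> Polys) \<Longrightarrow> poly.coeff (P * R) i \<in> Polys"
  unfolding coeff_mult by (intro Polys_sum) auto

lemma subalgebra_quotient_form: "subalgebra_Mero0 (quotient_form f)"
  unfolding subalgebra_Mero0_def
proof (intro conjI ballI allI)
  show "quotient_form f \<subseteq> Mero0" unfolding quotient_form_def Mero0_def by blast
  show "1 \<in> quotient_form f" using quotient_formI[of 1 1 f] by (simp add: one_poly_eq_simps(1)[symmetric] coeff_1)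
next
  fix c a assume "a \<in> quotient_form f"
  then obtain P q where *: "a = to_fract (poly P f) / to_fract q" "\<And>i. poly.coeff P i \<in> Polys" "q \<in> Polys" "q \<noteq> 0"
    unfolding quotient_form_def by blast
  then show "to_fract (const_entire c) * a \<in> quotient_form f"
    using quotient_formI[of "Polynomial.smult (const_entire c) P" q f] by simp
next
  fix a b assume "a \<in> quotient_form f" "b \<in> quotient_form f"
  then obtain P q R s where *: "a = to_fract (poly P f) / to_fract q" "\<And>i. poly.coeff P i \<in> Polys" "q \<in> Polys" "q \<noteq> 0"
    "b = to_fract (poly R f) / to_fract s" "\<And>i. poly.coeff R i \<in> Polys" "s \<in> Polys" "s \<noteq> 0"
    unfolding quotient_form_def by blast
  show "a + b \<in> quotient_form f"
    using quotient_formI[of "Polynomial.smult s P + Polynomial.smult q R" "q * s" f] *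
    by (simp add: add_frac_eq mult_ac)
  show "a * b \<in> quotient_form f"
    using quotient_formI[of "P * R" "q * s" f] * coeff_mult_Polys[of P R] by simp
qed

lemma Rats_n_subset_quotient_form: "Rats_n \<subseteq> quotient_form f"
proof
  fix r :: "'a entire fract" assume "r \<in> Rats_n"
  then obtain p q where *: "r = to_fract p / to_fract q" "p \<in> Polys" "q \<in> Polys" "q \<noteq> 0"
    unfolding Rats_n_def by blast
  then show "r \<in> quotient_form f"
    using quotient_formI[of "[:p:]" q f] by (simp add: coeff_pCons split: nat.split)
qed

lemma mem_quotient_form: "to_fract f \<in> quotient_form f"
  using quotient_formI[of "[:0, 1:]" 1 f] by (simp add: coeff_pCons split: nat.split)

lemma Rats_adjoin_subset_quotient_form: "Rats_adjoin (to_fract f) \<subseteq> quotient_form f"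
  unfolding Rats_adjoin_def
  using Rats_n_subset_quotient_form mem_quotient_form subalgebra_quotient_form
  by (intro hull_minimal) auto

lemma subalgebra_Rats_adjoin: "subalgebra_Mero0 (Rats_adjoin (to_fract f))"
proof -
  have "Rats_adjoin (to_fract f) \<subseteq> Mero0"
    using Rats_adjoin_subset_quotient_form subalgebra_quotient_form unfolding subalgebra_Mero0_def by blast
  then show ?thesis
    unfolding subalgebra_Mero0_def Rats_adjoin_def hull_def by auto
qed

lemma Rats_adjoin_contains: "Rats_n \<subseteq> Rats_adjoin g" "g \<in> Rats_adjoin g"
  unfolding Rats_adjoin_def using hull_subset[of "Rats_n \<union> {g}"] by auto

lemma Rats_adjoin_subset:
  "to_fract g \<in> Rats_adjoin (to_fract f) \<Longrightarrow> Rats_adjoin (to_fract g) \<subseteq> Rats_adjoin (to_fract f)"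
  unfolding Rats_adjoin_def[of "to_fract g"]
  by (intro hull_minimal subalgebra_Rats_adjoin) (use Rats_adjoin_contains in auto)

lemma Rats_n_divide: "a \<in> Rats_n \<Longrightarrow> b \<in> Rats_n \<Longrightarrow> a / b \<in> Rats_n"
proof -
  assume "a \<in> Rats_n" "b \<in> Rats_n"
  then obtain p q r s where *: "a = to_fract p / to_fract q" "p \<in> Polys" "q \<in> Polys" "q \<noteq> 0"
    "b = to_fract r / to_fract s" "r \<in> Polys" "s \<in> Polys" "s \<noteq> 0"
    unfolding Rats_n_def by blast
  show ?thesis
  proof (cases "r = 0")
    case True
    have "to_fract (0 :: 'a entire) / to_fract 1 \<in> Rats_n" unfolding Rats_n_def
      by (intro CollectI exI[of _ 0] exI[of _ 1]) auto
    then show ?thesis using True * by simp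
  next
    case False
    have "to_fract (p * s) / to_fract (q * r) \<in> Rats_n"
      unfolding Rats_n_def using * False by (intro CollectI exI[of _ "p * s"] exI[of _ "q * r"]) auto
    then show ?thesis using * by (simp add: divide_divide_eq_left divide_divide_eq_right mult_ac)
  qed
qed

lemma to_fract_mem_Rats_n: "p \<in> Polys \<Longrightarrow> to_fract p \<in> Rats_n"
  unfolding Rats_n_def by (intro CollectI exI[of _ p] exI[of _ 1]) auto

lemma Rats_n_uminus: "a \<in> Rats_n \<Longrightarrow> - a \<in> Rats_n"
  unfolding Rats_n_def by (auto, metis Polys_uminus minus_divide_left to_fract_uminus)

lemma entire_Rats_n_imp_Polys:
  assumes "to_fract f \<in> Rats_n" shows "f \<in> Polys"
proof -
  obtain p q where *: "to_fract f = to_fract p / to_fract q" "p \<in> Polys" "q \<in> Polys" "q \<noteq> 0"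
    using assms unfolding Rats_n_def by blast
  then have "to_fract (q * f) = to_fract p" by (simp add: field_simps)
  then have "q * f ^ 1 = p" by (simp only: to_fract_eq_iff power_one_right)
  then show ?thesis using Polys_of_power_eq[of q p 1 f] * by simp
qed

lemma exp_entire_of_nat_mult: "exp_entire (of_nat m * p) = exp_entire p ^ m"
  by (intro entire_eqI) (simp add: exp_of_nat_mult)

lemma Rats_adjoin_exp_imp_nonconst:
  assumes "transcendental f" and eq: "Rats_adjoin (to_fract f) = Rats_adjoin (to_fract (exp_entire p))"
  shows "\<nexists>c. p = const_entire c"
proof
  assume "\<exists>c. p = const_entire c"
  then obtain c where "p = const_entire c" by blast
  then have "exp_entire p = const_entire (exp c)" by (intro entire_eqI) simp
  then have const: "exp_entire p \<in> Polys" by simp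
  obtain P q where *: "to_fract f = to_fract (poly P (exp_entire p)) / to_fract q"
    "\<And>i. poly.coeff P i \<in> Polys" "q \<in> Polys" "q \<noteq> 0"
    using Rats_adjoin_contains(2)[of "to_fract f"] Rats_adjoin_subset_quotient_form[of "exp_entire p"]
    unfolding eq quotient_form_def by blast
  have "poly P (exp_entire p) \<in> Polys"
    unfolding poly_altdef using const * by (intro Polys_sum) auto
  then have "to_fract f \<in> Rats_n" unfolding Rats_n_def using * by blast
  then show False using entire_Rats_n_imp_Polys assms(1) unfolding transcendental_def by blast
qed

lemma Rats_adjoin_eq_of_affine:
  assumes f: "transcendental f" and q: "q1 \<in> Rats_n" "q2 \<in> Rats_n" and eq: "to_fract f = q1 * to_fract g + q2"
  shows "Rats_adjoin (to_fract f) = Rats_adjoin (to_fract g)"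
proof -
  have "q1 \<noteq> 0"
    using f eq q entire_Rats_n_imp_Polys[of f] unfolding transcendental_def by auto
  note closed = subalgebra_Rats_adjoin[unfolded subalgebra_Mero0_def] and sub = Rats_adjoin_contains
  have "to_fract f \<in> Rats_adjoin (to_fract g)"
    unfolding eq using closed[of g] sub[of "to_fract g"] q by blast
  moreover have "to_fract g \<in> Rats_adjoin (to_fract f)"
  proof -
    have "to_fract g = (1 / q1) * to_fract f + - (q2 / q1)"
      using \<open>q1 \<noteq> 0\<close> by (simp add: eq field_simps)
    moreover have "1 \<in> Rats_n" using to_fract_mem_Rats_n[of 1] by simp
    then have "1 / q1 \<in> Rats_n" "- (q2 / q1) \<in> Rats_n" using q by (auto intro: Rats_n_divide Rats_n_uminus)
    ultimately show ?thesis using closed[of f] sub[of "to_fract f"] by (metis subsetD)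
  qed
  ultimately show ?thesis using Rats_adjoin_subset by blast
qed

lemma exp_nontrivial_invertible:
  assumes "\<nexists>c. p = const_entire c"
  shows "nontrivial_invertible (to_fract (exp_entire p))"
proof -
  have "exp_entire p * exp_entire (- p) = 1" by (intro entire_eqI) (simp add: exp_minus)
  then have "to_fract (exp_entire p) * to_fract (exp_entire (- p)) = 1"
    by (metis to_fract_1 to_fract_mult)
  moreover have "to_fract h \<in> Mero0" for h :: "'a entire"
    unfolding Mero0_def by (intro CollectI exI[of _ h] exI[of _ 1]) auto
  moreover have "1 \<in> Rats_n" using to_fract_mem_Rats_n[of 1] by simp
  ultimately show ?thesis
    unfolding nontrivial_invertible_def invertible_Mero0_def using assms
    by (metis mult_1 one_neq_zero)
qed

lemma affine_exp_of_nontrivial_invertible: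
  assumes "finite_order f" "g \<in> Rats_adjoin (to_fract f)" "nontrivial_invertible g"
  shows "\<exists>q1\<in>Rats_n. \<exists>q2\<in>Rats_n. \<exists>p\<in>Polys. to_fract f = q1 * to_fract (exp_entire p) + q2"
proof -
  obtain N where N: "1 \<le> N" "\<And>a b. growth N (\<lambda>t. ev f (a + t *s b))"
    using finite_order_imp_growth_on_lines[OF assms(1)] by metis
  obtain R h where R: "R \<in> Rats_n" "R \<noteq> 0" and h: "\<nexists>c. h = const_entire c" "g = R * to_fract (exp_entire h)"
    using assms(3) unfolding nontrivial_invertible_def by blast
  obtain r s where r: "R = to_fract r / to_fract s" "r \<in> Polys" "s \<in> Polys" "s \<noteq> 0" "r \<noteq> 0"
    using R unfolding Rats_n_def by force
  obtain P q where P: "g = to_fract (poly P f) / to_fract q" "\<And>i. poly.coeff P i \<in> Polys" "q \<in> Polys" "q \<noteq> 0"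
    using assms(2) Rats_adjoin_subset_quotient_form unfolding quotient_form_def by blast
  have "to_fract (poly (Polynomial.smult s P) f) = to_fract (q * r * exp_entire h)"
    using P(1,4) r(1,4) h(2) by (simp add: field_simps)
  then have eq: "poly (Polynomial.smult s P) f = q * r * exp_entire h" by (simp only: to_fract_eq_iff)
  obtain \<alpha> \<beta> v p where *: "\<alpha> \<in> Polys" "\<beta> \<in> Polys" "v \<in> Polys" "p \<in> Polys" "\<alpha> \<noteq> 0"
    "\<alpha> * f + \<beta> = v * exp_entire p"
    by (rule affine_form_of_poly_times_exp[OF N _ _ _ h(1) eq]) (use P r in auto)
  from arg_cong[OF *(6), of to_fract]
  have "to_fract f = (to_fract v / to_fract \<alpha>) * to_fract (exp_entire p) + - (to_fract \<beta> / to_fract \<alpha>)"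
    using *(5) by (simp add: field_simps eq_diff_eq)
  then show ?thesis
    using * by (meson Rats_n_divide Rats_n_uminus to_fract_mem_Rats_n)
qed

lemma invertible_in_Rats_adjoin_exp:
  assumes p: "p \<in> Polys" "\<nexists>c. p = const_entire c"
    and g: "g \<in> Rats_adjoin (to_fract (exp_entire p))" "invertible_Mero0 g"
  shows "\<exists>m::nat. \<exists>r\<in>Rats_n. g = r * to_fract (exp_entire (of_nat m * p))"
proof -
  obtain P q where P: "g = to_fract (poly P (exp_entire p)) / to_fract q" "\<And>i. poly.coeff P i \<in> Polys" "q \<in> Polys" "q \<noteq> 0"
    using g(1) Rats_adjoin_subset_quotient_form unfolding quotient_form_def by blast
  obtain h s where h: "g * (to_fract h / to_fract s) = 1" "s \<in> Polys" "s \<noteq> 0"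
    using g(2) unfolding invertible_Mero0_def Mero0_def by blast
  have "to_fract (poly P (exp_entire p) * h) = to_fract (q * s)"
    using h(1,3) P(1,4) by (simp add: field_simps)
  then have eq: "poly P (exp_entire p) * h = q * s" by (simp only: to_fract_eq_iff)
  then have "poly P (exp_entire p) \<noteq> 0" using P(4) h(3) by auto
  then have "P \<noteq> 0" by auto
  define m where "m = degree P"
  have "poly.coeff P i = 0" if "i \<noteq> m" for i
    using single_term_of_poly_divisor_exp[OF p P(2) _ _ eq that] P(3,4) h(2,3) \<open>P \<noteq> 0\<close> by (simp add: m_def)
  then have "P = Polynomial.monom (poly.coeff P m) m" by (intro poly_eqI) (auto simp: coeff_monom)
  then have "poly P (exp_entire p) = poly.coeff P m * exp_entire (of_nat m * p)"
    by (metis poly_monom exp_entire_of_nat_mult)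
  then have "g = to_fract (poly.coeff P m) / to_fract q * to_fract (exp_entire (of_nat m * p))"
    by (simp add: P(1))
  moreover have "to_fract (poly.coeff P m) / to_fract q \<in> Rats_n"
    using P by (intro Rats_n_divide to_fract_mem_Rats_n)
  ultimately show ?thesis by blast
qed

theorem corollary4p2:
  fixes f :: "'n::finite entire"
  assumes "transcendental f" and "finite_order f"
  shows "((\<exists>g\<in>Rats_adjoin (to_fract f). nontrivial_invertible g) \<longleftrightarrow>
          (\<exists>q1\<in>Rats_n. \<exists>q2\<in>Rats_n. \<exists>p\<in>Polys. to_fract f = q1 * to_fract (exp_entire p) + q2)) \<and>
         ((\<exists>q1\<in>Rats_n. \<exists>q2\<in>Rats_n. \<exists>p\<in>Polys. to_fract f = q1 * to_fract (exp_entire p) + q2) \<longleftrightarrow>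
          (\<exists>p\<in>Polys. Rats_adjoin (to_fract f) = Rats_adjoin (to_fract (exp_entire p)))) \<and>
         (\<forall>p\<in>Polys.
           (\<exists>q1\<in>Rats_n. \<exists>q2\<in>Rats_n. to_fract f = q1 * to_fract (exp_entire p) + q2) \<or>
           Rats_adjoin (to_fract f) = Rats_adjoin (to_fract (exp_entire p)) \<longrightarrow>
           (\<forall>g\<in>Rats_adjoin (to_fract f). invertible_Mero0 g \<longrightarrow>
             (\<exists>m::nat. \<exists>r\<in>Rats_n. g = r * to_fract (exp_entire (of_nat m * p)))))"
    (is "(?i \<longleftrightarrow> ?ii) \<and> (?ii \<longleftrightarrow> ?iii) \<and> ?last")
proof -
  have "?i \<Longrightarrow> ?ii" using affine_exp_of_nontrivial_invertible[OF assms(2)] by blast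
  moreover have "?ii \<Longrightarrow> ?iii" using Rats_adjoin_eq_of_affine[OF assms(1)] by blast
  moreover have "?iii \<Longrightarrow> ?i"
  proof -
    assume ?iii
    then obtain p where p: "Rats_adjoin (to_fract f) = Rats_adjoin (to_fract (exp_entire p))" by blast
    have "nontrivial_invertible (to_fract (exp_entire p))"
      by (intro exp_nontrivial_invertible Rats_adjoin_exp_imp_nonconst[OF assms(1) p])
    then show ?i using Rats_adjoin_contains(2) p by metis
  qed
  moreover have ?last
  proof (intro ballI impI)
    fix p g
    assume p: "p \<in> Polys" and g: "g \<in> Rats_adjoin (to_fract f)" "invertible_Mero0 g"
      and "(\<exists>q1\<in>Rats_n. \<exists>q2\<in>Rats_n. to_fract f = q1 * to_fract (exp_entire p) + q2) \<or>
           Rats_adjoin (to_fract f) = Rats_adjoin (to_fract (exp_entire p))"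
    then have eq: "Rats_adjoin (to_fract f) = Rats_adjoin (to_fract (exp_entire p))"
      using Rats_adjoin_eq_of_affine[OF assms(1)] by blast
    show "\<exists>m::nat. \<exists>r\<in>Rats_n. g = r * to_fract (exp_entire (of_nat m * p))"
      using invertible_in_Rats_adjoin_exp[OF p Rats_adjoin_exp_imp_nonconst[OF assms(1) eq]] g
      unfolding eq by blast
  qed
  ultimately show ?thesis by blast
qed

end
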